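(* Let $F_1,F_2$ be rooted forests. Then $P_{F_1}=P_{F_2}$ if and only if $F_1\cong F_2$ (as rooted forests). Likewise, $S_{F_1}=S_{F_2}$ if and only if $F_1\cong F_2$. In other words, $P$ and $S$ are complete invariants for rooted forests.
   Context: A rooted tree is a finite tree with one distinguished vertex, its root. A rooted forest is a finite, possibly empty, disjoint union of rooted trees. An isomorphism of rooted forests is a graph isomorphism mapping roots to roots. A vertex is a leaf of a rooted forest if it has no children (an isolated vertex is both a root and a leaf). A leaf-induced subforest $F'$ of a rooted forest $F$ is a (possibly empty) union of paths each connecting the root of a component of $F$ to a leaf of $F$ in that component; equivalently $F'$ is determined by a subset of the leaves of $F$, each chosen leaf being joined to the root of its component. Define $P_F(x,y)=\sum_{F'} x^{|V(F')|}y^{|L(F')|}$, the sum over all leaf-induced subforests $F'$ of $F$, where $V(F')$, $L(F')$ are the vertex and leaf sets of $F'$. For a rooted tree $T$, a subtree is either the empty subgraph or a connected subgraph containing the root; it is identified with its vertex set. For a vertex set $S$, the boundary $\partial S$ is the set of vertices adjacent to some vertex of $S$ but not in $S$, with the convention $\partial\emptyset=\{\text{root}\}$. Define $S_T(x,y)=\sum_{T'} x^{|T'|}y^{|\partial T'|}$, the sum over all subtrees $T'$ of $T$. For a rooted forest $F$ with components $T_1,\dots,T_r$, set $S_F=\prod_{i=1}^r S_{T_i}$ (so $S$ of the empty forest is $1$). *)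

theory Defs
  imports "HOL-Computational_Algebra.Computational_Algebra"
begin

text \<open>An undirected edge is the two-element set of its ends; a graph carries a set of
  distinguished vertices, its roots.\<close>

record 'a rooted_graph =
  verts :: "'a set"
  edges :: "'a set set"
  roots :: "'a set"

definition simple_graph :: "'a rooted_graph \<Rightarrow> bool" where
  "simple_graph G \<longleftrightarrow>
     finite (verts G) \<and> (\<forall>e\<in>edges G. e \<subseteq> verts G \<and> card e = 2)"

definition graph_path :: "'a rooted_graph \<Rightarrow> 'a list \<Rightarrow> bool" where
  "graph_path G p \<longleftrightarrow>
     p \<noteq> [] \<and> set p \<subseteq> verts G \<and> distinct p \<and>
     (\<forall>i. Suc i < length p \<longrightarrow> {p ! i, p ! Suc i} \<in> edges G)"

definition linked :: "'a rooted_graph \<Rightarrow> 'a \<Rightarrow> 'a \<Rightarrow> bool" where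
  "linked G u v \<longleftrightarrow> (\<exists>p. graph_path G p \<and> hd p = u \<and> last p = v)"

definition connected_graph :: "'a rooted_graph \<Rightarrow> bool" where
  "connected_graph G \<longleftrightarrow>
     verts G \<noteq> {} \<and> (\<forall>u\<in>verts G. \<forall>v\<in>verts G. linked G u v)"

definition graph_cycle :: "'a rooted_graph \<Rightarrow> 'a list \<Rightarrow> bool" where
  "graph_cycle G p \<longleftrightarrow>
     graph_path G p \<and> 3 \<le> length p \<and> {last p, hd p} \<in> edges G"

definition rooted_tree :: "'a rooted_graph \<Rightarrow> bool" where
  "rooted_tree T \<longleftrightarrow>
     simple_graph T \<and> connected_graph T \<and> (\<nexists>p. graph_cycle T p) \<and>
     (\<exists>r\<in>verts T. roots T = {r})"

definition graph_union :: "'a rooted_graph set \<Rightarrow> 'a rooted_graph" where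
  "graph_union \<G> =
     \<lparr>verts = (\<Union>G\<in>\<G>. verts G), edges = (\<Union>G\<in>\<G>. edges G), roots = (\<Union>G\<in>\<G>. roots G)\<rparr>"

definition rooted_forest :: "'a rooted_graph \<Rightarrow> bool" where
  "rooted_forest F \<longleftrightarrow>
     (\<exists>\<T>. finite \<T> \<and> (\<forall>T\<in>\<T>. rooted_tree T) \<and>
          (\<forall>T\<in>\<T>. \<forall>T'\<in>\<T>. T \<noteq> T' \<longrightarrow> verts T \<inter> verts T' = {}) \<and>
          F = graph_union \<T>)"

definition rooted_iso :: "'a rooted_graph \<Rightarrow> 'b rooted_graph \<Rightarrow> bool" where
  "rooted_iso F F' \<longleftrightarrow>
     (\<exists>f. bij_betw f (verts F) (verts F') \<and>
          (\<forall>u\<in>verts F. \<forall>v\<in>verts F. {u, v} \<in> edges F \<longleftrightarrow> {f u, f v} \<in> edges F') \<and>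
          f ` roots F = roots F')"

definition induced :: "'a rooted_graph \<Rightarrow> 'a set \<Rightarrow> 'a rooted_graph" where
  "induced G S =
     \<lparr>verts = verts G \<inter> S, edges = {e \<in> edges G. e \<subseteq> S}, roots = roots G \<inter> S\<rparr>"

definition graph_components :: "'a rooted_graph \<Rightarrow> 'a rooted_graph set" where
  "graph_components G = (\<lambda>v. induced G {w. linked G v w}) ` verts G"

text \<open>Polynomials in two variables are polynomials in \<open>y\<close> over the polynomials in \<open>x\<close>.\<close>

definition var_x :: "int poly poly" where
  "var_x = [:[:0, 1:]:]"

definition var_y :: "int poly poly" where
  "var_y = [:0, 1:]"

text \<open>A neighbour \<open>w\<close> of \<open>v\<close> is a child of \<open>v\<close> if \<open>v\<close> lies on the path from the root to \<open>w\<close>.\<close>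

definition children :: "'a rooted_graph \<Rightarrow> 'a \<Rightarrow> 'a set" where
  "children F v =
     {w. {v, w} \<in> edges F \<and>
         (\<exists>p. graph_path F p \<and> hd p \<in> roots F \<and> last p = w \<and> v \<in> set p)}"

definition leaves :: "'a rooted_graph \<Rightarrow> 'a set" where
  "leaves F = {v \<in> verts F. children F v = {}}"

definition path_graph :: "'a list \<Rightarrow> 'a rooted_graph" where
  "path_graph p =
     \<lparr>verts = set p, edges = {{p ! i, p ! Suc i} | i. Suc i < length p}, roots = {hd p}\<rparr>"

definition root_leaf_paths :: "'a rooted_graph \<Rightarrow> 'a list set" where
  "root_leaf_paths F = {p. graph_path F p \<and> hd p \<in> roots F \<and> last p \<in> leaves F}"

definition leaf_induced_subforests :: "'a rooted_graph \<Rightarrow> 'a rooted_graph set" where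
  "leaf_induced_subforests F = {graph_union (path_graph ` \<P>) | \<P>. \<P> \<subseteq> root_leaf_paths F}"

text \<open>The exponent of \<open>y\<close> counts the leaves of the subforest itself.\<close>

definition P_poly :: "'a rooted_graph \<Rightarrow> int poly poly" where
  "P_poly F =
     (\<Sum>F'\<in>leaf_induced_subforests F. var_x ^ card (verts F') * var_y ^ card (leaves F'))"

definition subtrees :: "'a rooted_graph \<Rightarrow> 'a set set" where
  "subtrees T =
     {S. S \<subseteq> verts T \<and> (S = {} \<or> (roots T \<subseteq> S \<and> connected_graph (induced T S)))}"

definition boundary :: "'a rooted_graph \<Rightarrow> 'a set \<Rightarrow> 'a set" where
  "boundary T S =
     (if S = {} then roots T else {v \<in> verts T - S. \<exists>u\<in>S. {u, v} \<in> edges T})"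

definition S_tree :: "'a rooted_graph \<Rightarrow> int poly poly" where
  "S_tree T = (\<Sum>S\<in>subtrees T. var_x ^ card S * var_y ^ card (boundary T S))"

definition S_poly :: "'a rooted_graph \<Rightarrow> int poly poly" where
  "S_poly F = (\<Prod>T\<in>graph_components F. S_tree T)"

end

theory Submission
  imports Defs
begin

text \<open>
  Deleting the root of a tree \<open>T\<close> with root subtrees \<open>T\<^sub>1, \<dots>, T\<^sub>k\<close> gives the recursions
  \<open>S\<^sub>T = y + x S\<^bsub>T\<^sub>1\<^esub> \<dots> S\<^bsub>T\<^sub>k\<^esub>\<close> and \<open>P\<^sub>T = 1 - x + x P\<^bsub>T\<^sub>1\<^esub> \<dots> P\<^bsub>T\<^sub>k\<^esub>\<close>, where for \<open>P\<close> the product is read as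
  \<open>1 + y\<close> if \<open>k = 0\<close>; both polynomials are multiplicative on disjoint unions. They are
  irreducible by Eisenstein's criterion: \<open>S\<^sub>T\<close>, a monic polynomial in \<open>x\<close> with constant term
  \<open>y\<close>, at the prime \<open>y\<close>, and \<open>P\<^sub>T\<close>, a polynomial in \<open>z = 1 + y\<close>, at the prime \<open>1 - x\<close>. Unique
  factorization therefore recovers the multiset of the polynomials of the components of a forest,
  the sign being fixed by positivity at \<open>(1, 1)\<close>, and each of these determines the product over its
  root subtrees, so induction on the forest applies.
\<close>

section \<open>Ring homomorphisms and Eisenstein's criterion\<close>

text \<open>Eisenstein's criterion is available because both polynomials degenerate at a special
  value. For \<open>y = 0\<close> only the full tree survives in the sum for \<open>S\<close>, which
  becomes a power of \<open>x\<close>. For \<open>x = 1\<close> the sum for \<open>P\<close> counts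
  all sets of leaves by size and becomes a power of \<open>1 + y\<close>. Modulo the chosen prime
  each polynomial is therefore a monomial in its main variable. The condition on the square of the
  prime is immediate for \<open>S\<close>, but for \<open>P\<close> it needs an invariant that
  survives the recursion. Two obstacles shape the rest. In \<open>P\<close> a vertex without
  children replaces its product by \<open>1 + y\<close>, so no genuine product of tree polynomials
  may equal \<open>1 + y\<close>. And forests are given as bare graphs, possibly over different
  vertex types, without any inductive structure: an abstract type of unordered trees carries the
  algebra, and an inductive relation ties graphs to it.\<close>

locale unital_ring_hom =
  fixes h :: "'r::comm_ring_1 \<Rightarrow> 's::comm_ring_1"
  assumes hom_add: "h (a + b) = h a + h b"
    and hom_mult: "h (a * b) = h a * h b"
    and hom_one: "h 1 = 1"
begin

lemma hom_zero: "h 0 = 0"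
  using hom_add [of 0 0] by simp

lemma hom_diff: "h (a - b) = h a - h b"
  using hom_add [of "a - b" b] by simp

lemma hom_sum: "h (sum f A) = (\<Sum>i\<in>A. h (f i))"
  by (induction A rule: infinite_finite_induct) (simp_all add: hom_zero hom_add)

lemma hom_prod_mset: "h (prod_mset M) = prod_mset (image_mset h M)"
  by (induction M) (simp_all add: hom_one hom_mult)

end

lemma unital_ring_hom_comp:
  assumes "unital_ring_hom f" "unital_ring_hom g"
  shows "unital_ring_hom (\<lambda>a. g (f a))"
  using assms by (simp add: unital_ring_hom_def)

lemma unital_ring_hom_poly: "unital_ring_hom (\<lambda>p. poly p a)"
  by standard simp_all

lemma unital_ring_hom_pcompose: "unital_ring_hom (\<lambda>p. pcompose p r)"
  by standard (simp_all add: pcompose_add pcompose_mult pcompose_1)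

lemma unital_ring_hom_const: "unital_ring_hom (\<lambda>c. [:c:])"
  by standard (simp_all add: one_pCons mult.commute)

lemma unital_ring_hom_map_poly:
  assumes "unital_ring_hom h"
  shows "unital_ring_hom (map_poly h)"
proof -
  interpret unital_ring_hom h by fact
  show ?thesis
  proof
    show "map_poly h (a + b) = map_poly h a + map_poly h b" for a b
      by (rule poly_eqI) (simp add: coeff_map_poly hom_zero hom_add)
    show "map_poly h (a * b) = map_poly h a * map_poly h b" for a b
      by (rule poly_eqI) (simp add: coeff_map_poly hom_zero coeff_mult hom_sum hom_mult)
    show "map_poly h 1 = 1"
      by (simp add: hom_one)
  qed
qed

text \<open>Equal products of primes have the same factors only up to units; \<open>assoc\<close>
  removes the units, so the multisets themselves agree. A factor of \<open>A\<close> divides some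
  factor of \<open>B\<close>, hence equals it, and cancels.\<close>

lemma prod_mset_eq_imp_eq:
  fixes A B :: "'r::algebraic_semidom multiset"
  assumes "prod_mset A = prod_mset B"
    and prime: "\<And>p. p \<in># A + B \<Longrightarrow> prime_elem p"
    and assoc: "\<And>p q. p \<in># A + B \<Longrightarrow> q \<in># A + B \<Longrightarrow> p dvd q \<Longrightarrow> q dvd p \<Longrightarrow> p = q"
  shows "A = B"
  using assms
proof (induction A arbitrary: B)
  case empty
  show ?case
  proof (rule ccontr)
    assume "{#} \<noteq> B"
    then obtain b where b: "b \<in># B"
      using multiset_nonemptyE [of B] by auto
    then have "b dvd prod_mset B"
      by (rule dvd_prod_mset)
    then have "b dvd 1"
      using empty.prems(1) by simp
    moreover have "prime_elem b"
      using empty.prems(2) b by simp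
    ultimately show False
      by (simp add: prime_elem_def)
  qed
next
  case (add a A)
  have a: "prime_elem a"
    using add.prems(2) by simp
  have "a dvd prod_mset B"
    unfolding add.prems(1) [symmetric] by simp
  then obtain b where b: "b \<in># B" "a dvd b"
    by (rule prime_elem_dvd_prod_msetE [OF a])
  have "prime_elem b"
    using b(1) by (intro add.prems(2)) simp
  then have "b dvd a"
    using b(2) prime_elem_not_unit [OF a] by (rule prime_elemD2)
  then have "a = b"
    using b by (intro add.prems(3)) simp_all
  then obtain B' where B': "B = add_mset a B'"
    using b(1) by (metis multi_member_split)
  have "prod_mset A = prod_mset B'"
    using add.prems(1) a by (simp add: B' prime_elem_def)
  then have "A = B'"
  proof (rule add.IH)
    show "prime_elem p" if "p \<in># A + B'" for p
      using that by (intro add.prems(2)) (auto simp: B')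
    show "p = q" if "p \<in># A + B'" "q \<in># A + B'" "p dvd q" "q dvd p" for p q
      using that by (intro add.prems(3)) (auto simp: B')
  qed
  then show ?case
    by (simp add: B')
qed

text \<open>Modulo \<open>q\<close> such a polynomial is a nonzero multiple of its top monomial.
  This half of the criterion is closed under products and can be carried through the recursion; the
  condition on \<open>q * q\<close> is not multiplicative and is kept apart.\<close>

definition eisenstein :: "'r::idom \<Rightarrow> 'r poly \<Rightarrow> bool" where
  "eisenstein q p \<longleftrightarrow> \<not> q dvd lead_coeff p \<and> (\<forall>i<degree p. q dvd coeff p i)"

lemma eisenstein_one: "prime_elem q \<Longrightarrow> eisenstein q 1"
  by (simp add: eisenstein_def prime_elem_def)

lemma eisenstein_mult:
  assumes q: "prime_elem q" and f: "eisenstein q f" and g: "eisenstein q g"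
  shows "eisenstein q (f * g)"
proof -
  have "f \<noteq> 0" "g \<noteq> 0"
    using f g by (auto simp: eisenstein_def)
  then have deg: "degree (f * g) = degree f + degree g"
    by (rule degree_mult_eq)
  have "q dvd coeff (f * g) i" if "i < degree f + degree g" for i
    unfolding coeff_mult
  proof (rule dvd_sum)
    fix j assume "j \<in> {..i}"
    then have "j < degree f \<or> i - j < degree g"
      using that by auto
    then show "q dvd coeff f j * coeff g (i - j)"
      using f g by (auto simp: eisenstein_def)
  qed
  moreover have "\<not> q dvd lead_coeff (f * g)"
    using f g q by (simp add: lead_coeff_mult eisenstein_def prime_elem_dvd_mult_iff)
  ultimately show ?thesis
    by (simp add: eisenstein_def deg)
qed

lemma eisenstein_prod_mset:
  assumes "prime_elem q" "\<And>p. p \<in># M \<Longrightarrow> eisenstein q p"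
  shows "eisenstein q (prod_mset M)"
  using assms(2) by (induction M) (simp_all add: eisenstein_one eisenstein_mult assms(1))

text \<open>
  Otherwise, at the least \<open>i\<close> with \<open>q\<close> not dividing \<open>coeff f i\<close>, the coefficient of \<open>f * g\<close> is
  congruent to \<open>coeff f i * coeff g 0\<close> modulo \<open>q\<close>.
\<close>

lemma eisenstein_factor_degree_0:
  assumes q: "prime_elem q" and p: "eisenstein q (f * g)"
    and f: "q dvd coeff f 0" and g: "\<not> q dvd coeff g 0"
  shows "degree g = 0"
proof (rule ccontr)
  assume "degree g \<noteq> 0"
  have nz: "f \<noteq> 0" "g \<noteq> 0"
    using p by (auto simp: eisenstein_def)
  have "\<not> q dvd lead_coeff f"
    using p q by (auto simp: eisenstein_def lead_coeff_mult)
  then have ex: "\<exists>i. \<not> q dvd coeff f i" by blast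
  define i where "i = (LEAST i. \<not> q dvd coeff f i)"
  have i: "\<not> q dvd coeff f i"
    unfolding i_def using ex by (rule LeastI_ex)
  have less: "q dvd coeff f j" if "j < i" for j
    using not_less_Least [of j "\<lambda>i. \<not> q dvd coeff f i"] that unfolding i_def by blast
  have "coeff f i \<noteq> 0"
    using i by auto
  then have "i \<le> degree f"
    by (rule le_degree)
  \<comment> \<open>As \<open>degree g\<close> is nonzero, \<open>i \<le> degree f\<close> puts
    \<open>i\<close> strictly below the degree of the product, where \<open>q\<close> divides every
    coefficient.\<close>
  then have "q dvd coeff (f * g) i"
    using p nz \<open>degree g \<noteq> 0\<close> by (simp add: eisenstein_def degree_mult_eq)
  moreover have "coeff (f * g) i = (\<Sum>j<i. coeff f j * coeff g (i - j)) + coeff f i * coeff g 0"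
    unfolding coeff_mult lessThan_Suc_atMost [symmetric] by simp
  moreover have "q dvd (\<Sum>j<i. coeff f j * coeff g (i - j))"
    by (rule dvd_sum) (use less in auto)
  ultimately have "q dvd coeff f i * coeff g 0"
    by (simp add: dvd_add_right_iff)
  then show False
    using q i g by (simp add: prime_elem_dvd_mult_iff)
qed

text \<open>\<open>q\<close> divides exactly one of the two constant coefficients of a
  factorization, which forces the other factor to be constant. Over a coefficient ring that is not a
  field this does not yet make it a unit; \<open>primitive\<close> does.\<close>

lemma eisenstein_imp_irreducible:
  assumes q: "prime_elem q" and p: "eisenstein q p" and deg: "degree p \<noteq> 0"
    and sq: "\<not> q * q dvd coeff p 0"
    and primitive: "\<And>c. [:c:] dvd p \<Longrightarrow> c dvd 1"
  shows "irreducible p"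
proof (rule irreducibleI)
  show "p \<noteq> 0"
    using deg by auto
  show "\<not> p dvd 1"
    using deg by (auto simp: is_unit_poly_iff)
next
  fix f g assume fg: "p = f * g"
  have unit: "u dvd 1" if "degree u = 0" "u dvd p" for u
    using that primitive by (auto simp: is_unit_const_poly_iff elim!: degree_eq_zeroE)
  have "q dvd coeff p 0"
    using p deg by (simp add: eisenstein_def)
  then have "q dvd coeff f 0 \<or> q dvd coeff g 0"
    using q by (simp add: fg coeff_mult_0 prime_elem_dvd_mult_iff)
  moreover have "\<not> (q dvd coeff f 0 \<and> q dvd coeff g 0)"
    using sq by (auto simp: fg coeff_mult_0 intro: mult_dvd_mono)
  ultimately have "degree f = 0 \<or> degree g = 0"
    using eisenstein_factor_degree_0 [OF q, of f g] eisenstein_factor_degree_0 [OF q, of g f] p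
    by (auto simp: fg mult.commute)
  then show "f dvd 1 \<or> g dvd 1"
    using unit [of f] unit [of g] by (auto simp: fg)
qed

section \<open>Recursive polynomials of rooted trees\<close>

text \<open>Isomorphism classes of unordered rooted trees, free of any vertex type, so that forests
  over different types can be compared. The multiset forgets the order of the root subtrees and
  keeps multiplicities; a forest corresponds to a multiset of shapes.\<close>

datatype shape = Node "shape multiset"

primrec S_shape :: "'r::comm_ring_1 \<Rightarrow> 'r \<Rightarrow> shape \<Rightarrow> 'r" where
  "S_shape x y (Node M) = y + x * prod_mset (image_mset (S_shape x y) M)"

text \<open>The empty subforest counts \<open>1\<close> and does not acquire the root; all others
  do, hence the factor \<open>x\<close> on the product minus \<open>1\<close>. If \<open>M\<close>
  is empty, the root is itself a leaf and contributes \<open>y\<close>.\<close>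

primrec P_shape :: "'r::comm_ring_1 \<Rightarrow> 'r \<Rightarrow> shape \<Rightarrow> 'r" where
  "P_shape x y (Node M) =
     1 + x * ((if M = {#} then 1 + y else prod_mset (image_mset (P_shape x y) M)) - 1)"

text \<open>The recursion uses ring operations only, so swapping variables, shifting them and
  evaluating at points all amount to changing the two arguments.\<close>

lemma (in unital_ring_hom) hom_S_shape: "h (S_shape x y t) = S_shape (h x) (h y) t"
proof (induction t)
  case (Node M)
  then have "image_mset (\<lambda>t. h (S_shape x y t)) M = image_mset (S_shape (h x) (h y)) M"
    by (intro image_mset_cong)
  then show ?case
    by (simp add: hom_add hom_mult hom_prod_mset multiset.map_comp comp_def)
qed

lemma (in unital_ring_hom) hom_P_shape: "h (P_shape x y t) = P_shape (h x) (h y) t"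
proof (induction t)
  case (Node M)
  then have "image_mset (\<lambda>t. h (P_shape x y t)) M = image_mset (P_shape (h x) (h y)) M"
    by (intro image_mset_cong)
  then show ?case
    by (simp add: hom_add hom_mult hom_diff hom_one hom_prod_mset multiset.map_comp comp_def)
qed

text \<open>Injectivity is asked with one argument in \<open>M\<close> and the other arbitrary: the
  induction on shapes provides it in this form, for the root subtrees of one of the two
  trees.\<close>

lemma image_mset_inj:
  assumes "image_mset f M = image_mset f N"
    and "\<And>s t. s \<in># M \<Longrightarrow> f s = f t \<Longrightarrow> s = t"
  shows "M = N"
  using assms
proof (induction M arbitrary: N)
  case (add s M)
  then obtain t N' where "N = add_mset t N'" "f s = f t" "image_mset f M = image_mset f N'"
    by (metis image_mset_add_mset msed_map_invR)
  then show ?case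
    using add.IH [of N'] add.prems(2) by auto
qed simp

text \<open>Collects what each polynomial has to supply on its own; the descent by unique
  factorization is then carried out once for both. \<open>associated\<close> says that the values
  are normalized with respect to units.\<close>

locale complete_shape_invariant =
  fixes f :: "shape \<Rightarrow> 'r::algebraic_semidom"
  assumes prime: "prime_elem (f t)"
    and associated: "f s dvd f t \<Longrightarrow> f t dvd f s \<Longrightarrow> f s = f t"
    and node: "f (Node M) = f (Node N) \<Longrightarrow>
      prod_mset (image_mset f M) = prod_mset (image_mset f N)"
begin

lemma image_mset_eq:
  assumes "prod_mset (image_mset f M) = prod_mset (image_mset f N)"
  shows "image_mset f M = image_mset f N"
  by (rule prod_mset_eq_imp_eq [OF assms]) (use prime associated in auto)

lemma inj: "f s = f t \<Longrightarrow> s = t"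
proof (induction s arbitrary: t)
  case (Node M)
  obtain N where t: "t = Node N"
    by (cases t)
  have "image_mset f M = image_mset f N"
    using Node.prems unfolding t by (intro image_mset_eq node)
  then have "M = N"
    by (rule image_mset_inj) (use Node.IH in blast)
  then show ?case
    by (simp add: t)
qed

lemma prod_inj: "prod_mset (image_mset f M) = prod_mset (image_mset f N) \<Longrightarrow> M = N"
  using image_mset_inj [OF image_mset_eq] inj by blast

end

text \<open>Mutual divisibility leaves a unit, here the constant \<open>1\<close> or
  \<open>-1\<close>, and a common point with positive values excludes \<open>-1\<close>. The outer
  variable is evaluated before the inner one, so \<open>a\<close> is itself a polynomial.\<close>

lemma dvd_antisym_int_poly_poly:
  fixes p q :: "int poly poly"
  assumes "p dvd q" "q dvd p" and "poly (poly p a) b > 0" "poly (poly q a) b > 0"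
  shows "p = q"
proof -
  obtain u where u: "q = p * u"
    using assms(1) ..
  obtain v where v: "p = q * v"
    using assms(2) ..
  have "q \<noteq> 0"
    using assms(4) by auto
  moreover have "q * 1 = q * (v * u)"
    using u v by (simp add: mult.assoc)
  ultimately have "v * u = 1"
    by (metis mult_cancel_left)
  then have "u dvd 1"
    by (metis dvd_triv_right)
  then obtain c where c: "u = [:[:c:]:]" "c dvd 1"
    by (auto simp: is_unit_poly_iff)
  moreover have "poly (poly q a) b = poly (poly p a) b * c"
    by (simp add: u c(1))
  ultimately have "c = 1"
    using assms(3,4) by (auto simp: zero_less_mult_iff zdvd1_eq)
  then show ?thesis
    by (simp add: u c(1) flip: one_pCons)
qed

lemma prod_mset_pos:
  fixes f :: "'b \<Rightarrow> int"
  assumes "\<And>t. t \<in># M \<Longrightarrow> f t > 0"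
  shows "prod_mset (image_mset f M) > 0"
  using assms by (induction M) simp_all

text \<open>Additivity of degrees makes one factor constant, and this constant divides the unit
  \<open>c\<close>. The instances used are \<open>y\<close> and \<open>1 - x\<close>.\<close>

lemma prime_elem_linear:
  assumes "c dvd (1::int)"
  shows "prime_elem [:a, c:]"
proof -
  have "c \<noteq> 0"
    using assms by auto
  then have "prime_elem [:a, c:]" if "irreducible [:a, c:]"
    using that by (simp add: irreducible_imp_prime_elem)
  moreover have "irreducible [:a, c:]"
  proof (rule irreducibleI)
    fix f g assume fg: "[:a, c:] = f * g"
    have "f \<noteq> 0" "g \<noteq> 0"
      using fg \<open>c \<noteq> 0\<close> by auto
    then have "degree f + degree g = 1"
      using degree_mult_eq [of f g] \<open>c \<noteq> 0\<close> by (simp flip: fg)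
    then have "degree f = 0 \<or> degree g = 0" by linarith
    moreover have "lead_coeff f * lead_coeff g = c"
      using lead_coeff_mult [of f g] \<open>c \<noteq> 0\<close> by (simp flip: fg)
    then have "lead_coeff f dvd 1" "lead_coeff g dvd 1"
      using assms by (metis dvd_triv_left dvd_triv_right dvd_trans)+
    ultimately show "f dvd 1 \<or> g dvd 1"
      by (auto simp: is_unit_const_poly_iff elim!: degree_eq_zeroE)
  qed (use \<open>c \<noteq> 0\<close> in \<open>auto simp: is_unit_poly_iff\<close>)
  ultimately show ?thesis by simp
qed

text \<open>The outer variable is the paper's \<open>x\<close> here, so the two variables have changed places.\<close>

lemma S_shape_eisenstein:
  defines "y \<equiv> [:0, 1:] :: int poly"
  defines "f \<equiv> S_shape [:0, 1:] [:y:]"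
  shows "eisenstein y (f t) \<and> degree (f t) \<noteq> 0 \<and> lead_coeff (f t) = 1 \<and> coeff (f t) 0 = y"
proof (induction t)
  case (Node M)
  define p where "p = prod_mset (image_mset f M)"
  have f: "f (Node M) = pCons y p"
    by (simp add: f_def p_def)
  have "eisenstein y p"
    unfolding p_def using Node by (intro eisenstein_prod_mset) (auto simp: y_def prime_elem_linear)
  moreover have lead: "lead_coeff p = 1"
    unfolding p_def using Node by (induction M) (simp_all add: lead_coeff_mult)
  then have "p \<noteq> 0"
    by auto
  \<comment> \<open>\<open>pCons\<close> shifts the coefficients of \<open>p\<close> up by one
    degree and puts \<open>y\<close> underneath, so all coefficients below the leading one are still
    divisible by \<open>y\<close>.\<close>
  ultimately have "eisenstein y (pCons y p)"
    by (auto simp: eisenstein_def coeff_pCons split: nat.split)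
  then show ?case
    using lead \<open>p \<noteq> 0\<close> by (simp add: f)
qed

lemma S_shape_prime: "prime_elem (S_shape [:0, 1:] [:[:0, 1:]:] t :: int poly poly)" (is "prime_elem ?p")
proof (rule irreducible_imp_prime_elem, rule eisenstein_imp_irreducible)
  let ?y = "[:0, 1:] :: int poly"
  show "prime_elem ?y" "eisenstein ?y ?p" "degree ?p \<noteq> 0"
    using S_shape_eisenstein by (simp_all add: prime_elem_linear)
  have "coeff ?p 0 = ?y"
    using S_shape_eisenstein by simp
  moreover have "\<not> ?y * ?y dvd ?y"
    using dvd_times_left_cancel_iff [of ?y ?y 1] by (simp add: is_unit_poly_iff)
  ultimately show "\<not> ?y * ?y dvd coeff ?p 0"
    by simp
  \<comment> \<open>A constant factor divides every coefficient, in particular the leading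
    coefficient \<open>1\<close>.\<close>
  show "c dvd 1" if "[:c:] dvd ?p" for c
  proof -
    have "lead_coeff ?p = 1"
      using S_shape_eisenstein by simp
    then show ?thesis
      using that unfolding const_poly_dvd_iff by metis
  qed
qed

lemma S_shape_pos: "S_shape 1 1 t > (0::int)"
  by (induction t) (auto intro!: add_pos_pos prod_mset_pos)

text \<open>At \<open>x = 1\<close> the summands \<open>1\<close> and \<open>-1\<close> of the
  recursion cancel, leaving the product over the root subtrees, or \<open>2\<close> if there are
  none.\<close>

lemma P_shape_pos: "P_shape 1 1 t > (0::int)"
  by (induction t) (auto intro!: prod_mset_pos)

interpretation S: complete_shape_invariant "S_shape [:0, 1:] [:[:0, 1:]:] :: shape \<Rightarrow> int poly poly"
proof
  fix s t :: shape and M N :: "shape multiset"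
  let ?f = "S_shape [:0, 1:] [:[:0, 1:]:] :: shape \<Rightarrow> int poly poly"
  show "prime_elem (?f t)"
    by (rule S_shape_prime)
  have "poly (poly (?f t) 1) 1 > 0" for t
  proof -
    interpret unital_ring_hom "\<lambda>p :: int poly poly. poly (poly p 1) 1"
      by (rule unital_ring_hom_comp [OF unital_ring_hom_poly unital_ring_hom_poly])
    show ?thesis
      by (simp add: hom_S_shape S_shape_pos)
  qed
  then show "?f s = ?f t" if "?f s dvd ?f t" "?f t dvd ?f s"
    using that by (intro dvd_antisym_int_poly_poly)
  show "prod_mset (image_mset ?f M) = prod_mset (image_mset ?f N)" if "?f (Node M) = ?f (Node N)"
    using that by simp
qed

text \<open>
  The outer variable is \<open>z = 1 + y\<close>. The constant coefficient is \<open>(1 - x) d\<close>, and \<open>d(1) > 0\<close>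
  propagates because a product of two or more such coefficients is divisible by \<open>(1 - x)\<^sup>2\<close>.
\<close>

lemma P_shape_eisenstein:
  defines "q \<equiv> [:1, -1:] :: int poly"
  defines "f \<equiv> P_shape [:[:0, 1:]:] [:-1, 1:]"
  shows "eisenstein q (f t) \<and> degree (f t) \<noteq> 0 \<and> poly (f t) 1 = 1 \<and>
    (\<exists>d. coeff (f t) 0 = q * d \<and> poly d 1 > 0)"
proof (induction t)
  case (Node M)
  \<comment> \<open>The inequality is weakened to \<open>\<ge> 0\<close> because the value is
    \<open>0\<close> for the variable that stands in for the childless case and for every product of
    at least two factors. Adding the root restores strictness.\<close>
  define I where "I p \<longleftrightarrow> eisenstein q p \<and> degree p \<noteq> 0 \<and> poly p 1 = 1 \<and>
    (\<exists>d. coeff p 0 = q * d \<and> poly d 1 \<ge> 0)" for p :: "int poly poly"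
  have q: "prime_elem q" "poly q 1 = 0"
    by (simp_all add: q_def prime_elem_linear)
  have nz: "p \<noteq> 0" if "I p" for p
    using that by (auto simp: I_def)
  have I_mult: "I (p * r)" if "I p" "I r" for p r
  proof -
    obtain d e where "coeff p 0 = q * d" "coeff r 0 = q * e"
      using \<open>I p\<close> \<open>I r\<close> by (auto simp: I_def)
    then have "coeff (p * r) 0 = q * (q * (d * e))"
      by (simp add: coeff_mult_0)
    moreover have "poly (q * (d * e)) 1 = 0"
      by (simp add: q)
    ultimately have "\<exists>d. coeff (p * r) 0 = q * d \<and> poly d 1 \<ge> 0"
      by (metis order_refl)
    then show ?thesis
      using \<open>I p\<close> \<open>I r\<close> nz [of p] nz [of r] q(1)
      by (simp add: I_def eisenstein_mult degree_mult_eq)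
  qed
  have I_prod: "M \<noteq> {#} \<Longrightarrow> (\<And>t. t \<in># M \<Longrightarrow> I (f t)) \<Longrightarrow> I (prod_mset (image_mset f M))" for M
  proof (induction M)
    case (add t M)
    then show ?case
      by (cases "M = {#}") (auto intro: I_mult)
  qed simp
  have "I (f t)" if "t \<in># M" for t
    using Node [OF that] by (auto simp: I_def intro: less_imp_le)
  moreover have "I [:0, 1:]"
    using prime_elem_not_unit [OF q(1)]
    by (auto simp: I_def eisenstein_def intro!: exI [of _ 0])
  ultimately have I: "I p" if "p = (if M = {#} then [:0, 1:] else prod_mset (image_mset f M))" for p
    using that I_prod [of M] by auto
  define p where "p = (if M = {#} then [:0, 1:] else prod_mset (image_mset f M))"
  note I = I [OF p_def]
  have f: "f (Node M) = [:q:] + smult [:0, 1:] p"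
    by (simp add: f_def p_def q_def one_pCons algebra_simps)
  \<comment> \<open>\<open>p\<close> has positive degree, so the added constant \<open>[:q:]\<close>
    does not affect the degree.\<close>
  have deg: "degree (f (Node M)) = degree p"
    unfolding f using I by (subst degree_add_eq_right) (auto simp: I_def)
  have coeff: "coeff (f (Node M)) i = (if i = 0 then q else 0) + [:0, 1:] * coeff p i" for i
    by (simp add: f coeff_pCons split: nat.split)
  \<comment> \<open>This is the inner variable \<open>x\<close>. It does not vanish at
    \<open>1\<close>, where \<open>q\<close> does; multiplying by it therefore keeps the leading
    coefficient indivisible by \<open>q\<close>.\<close>
  have "\<not> q dvd [:0, 1:]"
  proof
    assume "q dvd [:0, 1:]"
    then have "poly q 1 dvd poly [:0, 1:] 1"
      by (metis dvd_def poly_mult)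
    then show False
      by (simp add: q)
  qed
  then have "eisenstein q (f (Node M))"
    using I q(1) unfolding eisenstein_def deg coeff
    by (auto simp: I_def eisenstein_def prime_elem_dvd_mult_iff simp del: mult_pCons_left)
  moreover have "poly (f (Node M)) 1 = 1"
    using I by (simp add: f I_def q_def one_pCons)
  moreover obtain d where d: "coeff p 0 = q * d" "poly d 1 \<ge> 0"
    using I by (auto simp: I_def)
  \<comment> \<open>The new cofactor takes at \<open>1\<close> the value
    \<open>1 + poly d 1\<close>, which is positive even if \<open>poly d 1\<close> is
    \<open>0\<close>.\<close>
  have "coeff (f (Node M)) 0 = q * (1 + [:0, 1:] * d)"
    unfolding coeff d by (simp add: algebra_simps)
  moreover have "poly (1 + [:0, 1:] * d) 1 > 0"
    using d(2) by simp
  ultimately show ?case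
    using I deg by (metis I_def)
qed

lemma P_shape_prime: "prime_elem (P_shape [:[:0, 1:]:] [:-1, 1:] t :: int poly poly)" (is "prime_elem ?p")
proof (rule irreducible_imp_prime_elem, rule eisenstein_imp_irreducible)
  let ?q = "[:1, -1:] :: int poly"
  show "prime_elem ?q" "eisenstein ?q ?p" "degree ?p \<noteq> 0"
    using P_shape_eisenstein by (simp_all add: prime_elem_linear)
  obtain d where d: "coeff ?p 0 = ?q * d" "poly d 1 > 0"
    using P_shape_eisenstein by blast
  show "\<not> ?q * ?q dvd coeff ?p 0"
  proof
    assume "?q * ?q dvd coeff ?p 0"
    then have "?q dvd d"
      unfolding d(1) by (subst (asm) dvd_times_left_cancel_iff) simp_all
    then have "poly d 1 = 0"
      by (auto elim!: dvdE)
    then show False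
      using d(2) by simp
  qed
  \<comment> \<open>The leading coefficient is a multiple of \<open>x\<close> here, so primitivity
    comes from the value at \<open>z = 1\<close>, that is \<open>y = 0\<close>: only the empty
    subforest survives there and the value is \<open>1\<close>.\<close>
  show "c dvd 1" if c: "[:c:] dvd ?p" for c
  proof -
    have "poly ?p 1 = 1"
      using P_shape_eisenstein by simp
    moreover obtain r where "?p = [:c:] * r"
      using c ..
    ultimately have "1 = c * poly r 1"
      by (metis mult.commute mult.left_neutral poly_pCons poly_mult poly_0 mult_zero_right add.right_neutral)
    then show ?thesis
      by (rule dvdI)
  qed
qed

interpretation P: complete_shape_invariant "P_shape [:[:0, 1:]:] [:-1, 1:] :: shape \<Rightarrow> int poly poly"
proof
  fix s t :: shape and M N :: "shape multiset"
  let ?f = "P_shape [:[:0, 1:]:] [:-1, 1:] :: shape \<Rightarrow> int poly poly"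
  have eval: "poly (poly (?f t) [:a:]) b = P_shape b (a - 1) t" for a b t
  proof -
    interpret unital_ring_hom "\<lambda>p :: int poly poly. poly (poly p [:a:]) b"
      by (rule unital_ring_hom_comp [OF unital_ring_hom_poly unital_ring_hom_poly])
    show ?thesis
      by (simp add: hom_P_shape)
  qed
  show "prime_elem (?f t)"
    by (rule P_shape_prime)
  \<comment> \<open>The outer variable is \<open>1 + y\<close>, so the point with
    \<open>x = y = 1\<close> is reached at \<open>2\<close>.\<close>
  have "poly (poly (?f t) [:2:]) 1 > 0" for t
    by (simp add: eval P_shape_pos)
  then show "?f s = ?f t" if "?f s dvd ?f t" "?f t dvd ?f s"
    using that by (intro dvd_antisym_int_poly_poly)
  \<comment> \<open>Separates the childless case, where \<open>[:0, 1:]\<close> replaces the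
    product, from all products of tree polynomials: at \<open>x = 0\<close> every tree polynomial is
    \<open>1\<close>, whereas the outer variable can be set to \<open>0\<close>.\<close>
  have ne: "prod_mset (image_mset ?f M) \<noteq> [:0, 1:]" for M
  proof
    interpret unital_ring_hom "\<lambda>p :: int poly poly. poly (poly p 0) 0"
      by (rule unital_ring_hom_comp [OF unital_ring_hom_poly unital_ring_hom_poly])
    have "P_shape 0 y t = 1" for y :: int and t
      by (cases t) simp
    then have "poly (poly (?f t) 0) 0 = 1" for t
      by (simp add: hom_P_shape)
    then have "poly (poly (prod_mset (image_mset ?f M)) 0) 0 = 1"
      by (simp add: hom_prod_mset multiset.map_comp comp_def image_mset_const_eq)
    moreover assume "prod_mset (image_mset ?f M) = [:0, 1:]"
    ultimately show False
      by simp
  qed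
  show "prod_mset (image_mset ?f M) = prod_mset (image_mset ?f N)" if "?f (Node M) = ?f (Node N)"
  proof -
    let ?p = "\<lambda>M. if M = {#} then 1 + [:-1, 1:] else prod_mset (image_mset ?f M)"
    have "[:[:0, 1:]:] * (?p M - 1) = [:[:0, 1:]:] * (?p N - 1)"
      using that unfolding P_shape.simps by (rule add_left_imp_eq)
    then have "?p M - 1 = ?p N - 1"
      by (subst (asm) mult_left_cancel) simp_all
    then have "?p M = ?p N"
      by (simp only: diff_left_imp_eq add_right_cancel diff_conv_add_uminus)
    moreover have "1 + [:-1, 1:] = ([:0, 1:] :: int poly poly)"
      by (simp add: one_pCons)
    ultimately show ?thesis
      using ne [of M] ne [of N] by (cases "M = {#}"; cases "N = {#}") simp_all
  qed
qed

section \<open>Return to the variables \<open>var_x\<close> and \<open>var_y\<close>\<close>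

text \<open>This exchanges the two variables: a new innermost variable is adjoined to the scalars
  and the old outer variable is evaluated at it, so that the old inner variable ends up
  outermost.\<close>

lemma unital_ring_hom_swap:
  "unital_ring_hom (\<lambda>p :: 'r::comm_ring_1 poly poly. poly (map_poly (map_poly (\<lambda>c. [:c:])) p) [:[:0, 1:]:])"
  by (rule unital_ring_hom_comp [OF unital_ring_hom_map_poly [OF unital_ring_hom_map_poly
          [OF unital_ring_hom_const]] unital_ring_hom_poly])

lemma S_shape_complete:
  assumes "prod_mset (image_mset (S_shape var_x var_y) M) = prod_mset (image_mset (S_shape var_x var_y) N)"
  shows "M = N"
proof (rule S.prod_inj)
  let ?swap = "\<lambda>p :: int poly poly. poly (map_poly (map_poly (\<lambda>c. [:c:])) p) [:[:0, 1:]:]"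
  interpret unital_ring_hom ?swap
    by (rule unital_ring_hom_swap)
  have x: "?swap var_x = [:0, 1:]" and y: "?swap var_y = [:[:0, 1:]:]"
    by (simp_all add: var_x_def var_y_def map_poly_pCons one_pCons)
  have "?swap (prod_mset (image_mset (S_shape var_x var_y) M)) =
      prod_mset (image_mset (S_shape [:0, 1:] [:[:0, 1:]:]) M)" for M
    by (simp only: hom_prod_mset multiset.map_comp comp_def hom_S_shape x y)
  then show "prod_mset (image_mset (S_shape [:0, 1:] [:[:0, 1::int:]:]) M) =
      prod_mset (image_mset (S_shape [:0, 1:] [:[:0, 1:]:]) N)"
    using assms by metis
qed

lemma P_shape_complete:
  assumes "prod_mset (image_mset (P_shape var_x var_y) M) = prod_mset (image_mset (P_shape var_x var_y) N)"
  shows "M = N"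
proof (rule P.prod_inj)
  \<comment> \<open>Substitutes \<open>z - 1\<close> for \<open>y\<close>, where \<open>z\<close> is
    the outer variable for which irreducibility was shown.\<close>
  interpret unital_ring_hom "\<lambda>p. pcompose p [:-1, 1 :: int poly:]"
    by (rule unital_ring_hom_pcompose)
  have "pcompose (prod_mset (image_mset (P_shape var_x var_y) M)) [:-1, 1:] =
      prod_mset (image_mset (P_shape [:[:0, 1::int:]:] [:-1, 1:]) M)" for M
    by (simp add: hom_prod_mset multiset.map_comp comp_def hom_P_shape var_x_def var_y_def pcompose_pCons)
  then show "prod_mset (image_mset (P_shape [:[:0, 1::int:]:] [:-1, 1:]) M) =
      prod_mset (image_mset (P_shape [:[:0, 1:]:] [:-1, 1:]) N)"
    using assms by metis
qed

section \<open>Paths, disjoint unions and adding a root\<close>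

lemma graph_path_Cons:
  "graph_path G (v # p) \<longleftrightarrow>
     v \<in> verts G \<and> v \<notin> set p \<and> (p = [] \<or> {v, hd p} \<in> edges G \<and> graph_path G p)"
proof (cases p)
  case (Cons w q)
  have "(\<forall>i. Suc i < length (v # p) \<longrightarrow> {(v # p) ! i, (v # p) ! Suc i} \<in> edges G) \<longleftrightarrow>
      {v, hd p} \<in> edges G \<and> (\<forall>i. Suc i < length p \<longrightarrow> {p ! i, p ! Suc i} \<in> edges G)"
    unfolding Cons by (auto simp: nth_Cons split: nat.splits)
  then show ?thesis
    by (auto simp: graph_path_def Cons)
qed (simp add: graph_path_def)

lemma graph_path_Nil [simp]: "\<not> graph_path G []"
  by (simp add: graph_path_def)

lemma graph_path_verts: "graph_path G p \<Longrightarrow> set p \<subseteq> verts G"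
  by (simp add: graph_path_def)

lemma graph_path_suffix: "graph_path G (p @ q) \<Longrightarrow> q \<noteq> [] \<Longrightarrow> graph_path G q"
  by (induction p) (auto simp: graph_path_Cons)

lemma graph_path_prefix: "graph_path G (p @ q) \<Longrightarrow> p \<noteq> [] \<Longrightarrow> graph_path G p"
  by (induction p) (auto simp: graph_path_Cons)

lemma linked_refl: "v \<in> verts G \<Longrightarrow> linked G v v"
  unfolding linked_def by (rule exI [of _ "[v]"]) (simp add: graph_path_Cons)

lemma linked_verts: "linked G u v \<Longrightarrow> u \<in> verts G \<and> v \<in> verts G"
  unfolding linked_def by (metis graph_path_Nil graph_path_verts hd_in_set last_in_set subsetD)

text \<open>Paths have distinct vertices, so \<open>u\<close> can be prepended only if it is new. If
  it already lies on the path, the suffix starting at \<open>u\<close> serves instead.\<close>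

lemma linked_step:
  assumes "{u, v} \<in> edges G" "u \<in> verts G" "linked G v w"
  shows "linked G u w"
proof -
  obtain p where p: "graph_path G p" "hd p = v" "last p = w"
    using assms(3) by (auto simp: linked_def)
  have "p \<noteq> []"
    using p(1) by auto
  show ?thesis
  proof (cases "u \<in> set p")
    case True
    then obtain q q' where "p = q @ u # q'"
      by (meson split_list)
    then have "graph_path G (u # q')" "last (u # q') = w"
      using p graph_path_suffix [of G q "u # q'"] by auto
    then show ?thesis
      unfolding linked_def by (metis list.sel(1))
  next
    case False
    then have "graph_path G (u # p)" "last (u # p) = w"
      using p assms \<open>p \<noteq> []\<close> by (auto simp: graph_path_Cons)
    then show ?thesis
      unfolding linked_def by (metis list.sel(1))
  qed
qed

lemma linked_trans:
  assumes "linked G u v" "linked G v w"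
  shows "linked G u w"
proof -
  have "graph_path G p \<Longrightarrow> last p = v \<Longrightarrow> linked G (hd p) w" for p
  proof (induction p)
    case (Cons a p)
    then show ?case
      using assms(2) by (cases "p = []") (auto simp: graph_path_Cons intro: linked_step)
  qed simp
  then show ?thesis
    using assms(1) unfolding linked_def by blast
qed

lemma linked_sym:
  assumes "linked G u v"
  shows "linked G v u"
proof -
  have "graph_path G p \<Longrightarrow> linked G (last p) (hd p)" for p
  proof (induction p)
    case (Cons a p)
    show ?case
    proof (cases "p = []")
      case True
      then show ?thesis
        using Cons.prems by (simp add: graph_path_Cons linked_refl)
    next
      case False
      then have p: "graph_path G p" "{hd p, a} \<in> edges G" "a \<in> verts G"
        using Cons.prems by (auto simp: graph_path_Cons insert_commute)
      then have "hd p \<in> verts G"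
        using False graph_path_verts [of G p] by auto
      then have "linked G (hd p) a"
        using p by (intro linked_step [OF p(2)] linked_refl)
      then show ?thesis
        using linked_trans [OF Cons.IH [OF p(1)]] False by simp
    qed
  qed simp
  then show ?thesis
    using assms unfolding linked_def by blast
qed

lemma linked_path_hd:
  assumes "graph_path G p" "v \<in> set p"
  shows "linked G (hd p) v"
proof -
  obtain q q' where p: "p = (q @ [v]) @ q'"
    using assms(2) by (metis append.assoc append_Cons append_Nil split_list)
  then have "graph_path G (q @ [v])"
    using assms(1) graph_path_prefix by blast
  then show ?thesis
    unfolding linked_def p by (intro exI [of _ "q @ [v]"]) (auto simp: hd_append)
qed

lemma graph_path_induced: "graph_path (induced G S) p \<longleftrightarrow> graph_path G p \<and> set p \<subseteq> S"
proof (induction p)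
  case (Cons v p)
  have "p \<noteq> [] \<Longrightarrow> hd p \<in> set p"
    by simp
  with Cons show ?case
    by (auto simp: graph_path_Cons) (auto simp: induced_def)
qed simp

section \<open>Well-formed graphs, disjoint sums and new roots\<close>

lemma rooted_graph_eqI:
  fixes G H :: "'a rooted_graph"
  assumes "verts G = verts H" "edges G = edges H" "roots G = roots H"
  shows "G = H"
  using assms by simp

text \<open>A condition shared by forests, leaf-induced subforests and path graphs. It confines
  edges and roots to the vertex set, which is what makes disjoint sums and new roots behave.\<close>

definition rgraph :: "'a rooted_graph \<Rightarrow> bool" where
  "rgraph G \<longleftrightarrow> simple_graph G \<and> roots G \<subseteq> verts G"

lemma rgraphD:
  assumes "rgraph G"
  shows "finite (verts G)" "e \<in> edges G \<Longrightarrow> e \<subseteq> verts G" "e \<in> edges G \<Longrightarrow> card e = 2"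
    "e \<in> edges G \<Longrightarrow> e \<noteq> {}" "roots G \<subseteq> verts G"
  using assms by (auto simp: rgraph_def simple_graph_def)

lemma rgraph_edge: "rgraph G \<Longrightarrow> {u, v} \<in> edges G \<Longrightarrow> u \<in> verts G \<and> v \<in> verts G \<and> u \<noteq> v"
  by (auto dest: rgraphD)

definition null_graph :: "'a rooted_graph" where
  "null_graph = \<lparr>verts = {}, edges = {}, roots = {}\<rparr>"

definition graph_sum :: "'a rooted_graph \<Rightarrow> 'a rooted_graph \<Rightarrow> 'a rooted_graph" where
  "graph_sum F G =
     \<lparr>verts = verts F \<union> verts G, edges = edges F \<union> edges G, roots = roots F \<union> roots G\<rparr>"

text \<open>The inverse of deleting the root of a tree: the former roots become the children of
  \<open>r\<close>.\<close>

definition add_root :: "'a \<Rightarrow> 'a rooted_graph \<Rightarrow> 'a rooted_graph" where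
  "add_root r F =
     \<lparr>verts = insert r (verts F), edges = edges F \<union> {{r, s} | s. s \<in> roots F}, roots = {r}\<rparr>"

lemma null_graph_simps [simp]:
  "verts null_graph = {}" "edges null_graph = {}" "roots null_graph = {}"
  by (simp_all add: null_graph_def)

lemma graph_sum_simps [simp]:
  "verts (graph_sum F G) = verts F \<union> verts G" "edges (graph_sum F G) = edges F \<union> edges G"
  "roots (graph_sum F G) = roots F \<union> roots G"
  by (simp_all add: graph_sum_def)

lemma add_root_simps [simp]:
  "verts (add_root r F) = insert r (verts F)"
  "edges (add_root r F) = edges F \<union> {{r, s} | s. s \<in> roots F}" "roots (add_root r F) = {r}"
  by (simp_all add: add_root_def)

lemma graph_union_simps [simp]:
  "verts (graph_union \<G>) = (\<Union>G\<in>\<G>. verts G)" "edges (graph_union \<G>) = (\<Union>G\<in>\<G>. edges G)"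
  "roots (graph_union \<G>) = (\<Union>G\<in>\<G>. roots G)"
  by (simp_all add: graph_union_def)

lemma graph_union_empty: "graph_union {} = null_graph"
  by (simp add: graph_union_def null_graph_def)

lemma graph_union_Un: "graph_union (\<A> \<union> \<B>) = graph_sum (graph_union \<A>) (graph_union \<B>)"
  by (simp add: graph_union_def graph_sum_def)

lemma graph_union_insert: "graph_union (insert G \<G>) = graph_sum G (graph_union \<G>)"
  by (simp add: graph_union_def graph_sum_def)

lemma graph_sum_left_commute: "graph_sum F (graph_sum G H) = graph_sum G (graph_sum F H)"
  by (auto simp: graph_sum_def)

lemma rgraph_null [simp]: "rgraph null_graph"
  by (simp add: rgraph_def simple_graph_def)

lemma rgraph_sum: "rgraph F \<Longrightarrow> rgraph G \<Longrightarrow> rgraph (graph_sum F G)"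
  by (auto simp: rgraph_def simple_graph_def)

lemma rgraph_add_root:
  assumes "rgraph F" "r \<notin> verts F"
  shows "rgraph (add_root r F)"
proof -
  have "card {r, s} = 2" if "s \<in> roots F" for s
    using that assms by (auto simp: rgraph_def card_insert_if)
  then show ?thesis
    using assms by (fastforce simp: rgraph_def simple_graph_def)
qed

lemma graph_path_sum:
  assumes F: "rgraph F" and G: "rgraph G" and disj: "verts F \<inter> verts G = {}"
  shows "graph_path (graph_sum F G) p \<longleftrightarrow> graph_path F p \<or> graph_path G p"
proof (induction p)
  case (Cons v p)
  show ?case
  proof (cases "p = []")
    case False
    then have "hd p \<in> set p"
      by simp
    then have "graph_path F p \<Longrightarrow> hd p \<in> verts F" "graph_path G p \<Longrightarrow> hd p \<in> verts G"
      using graph_path_verts by blast+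
    then show ?thesis
      using Cons.IH False disj rgraph_edge [OF F, of v "hd p"] rgraph_edge [OF G, of v "hd p"]
      by (auto simp: graph_path_Cons)
  qed (simp add: graph_path_Cons)
qed simp

lemma graph_path_add_root_avoiding:
  assumes "r \<notin> set p"
  shows "graph_path (add_root r F) p \<longleftrightarrow> graph_path F p"
  using assms
proof (induction p)
  case (Cons v p)
  then have "p \<noteq> [] \<Longrightarrow> hd p \<noteq> r"
    by (metis hd_in_set list.set_intros(2))
  with Cons show ?case
    by (auto simp: graph_path_Cons doubleton_eq_iff)
qed simp

lemma add_root_edge:
  assumes "rgraph F" "r \<notin> verts F"
  shows "{r, s} \<in> edges (add_root r F) \<longleftrightarrow> s \<in> roots F"
  using rgraph_edge [OF assms(1)] assms(2) by (auto simp: doubleton_eq_iff)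

text \<open>Children, paths to leaves and subtrees can all be expressed by such paths, so the rules
  for \<open>graph_sum\<close> and \<open>add_root\<close> below carry over to each of them.\<close>

definition root_path :: "'a rooted_graph \<Rightarrow> 'a list \<Rightarrow> bool" where
  "root_path F p \<longleftrightarrow> graph_path F p \<and> hd p \<in> roots F"

lemma root_path_verts: "root_path F p \<Longrightarrow> p \<noteq> [] \<and> set p \<subseteq> verts F \<and> last p \<in> verts F"
  unfolding root_path_def by (metis graph_path_Nil graph_path_verts last_in_set subsetD)

lemma graph_path_add_root_Cons:
  assumes "rgraph F" "r \<notin> verts F"
  shows "graph_path (add_root r F) (r # q) \<longleftrightarrow> q = [] \<or> root_path F q"
proof -
  have "r \<notin> set q" if "root_path F q"
    using root_path_verts [OF that] assms(2) by blast
  then show ?thesis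
    using graph_path_add_root_avoiding [of r q F] add_root_edge [OF assms, of "hd q"]
    unfolding graph_path_Cons root_path_def
    by (auto simp del: add_root_simps(2))
qed

lemma root_path_add_root:
  assumes "rgraph F" "r \<notin> verts F"
  shows "root_path (add_root r F) p \<longleftrightarrow> p = [r] \<or> (\<exists>q. p = r # q \<and> root_path F q)"
  using graph_path_add_root_Cons [OF assms]
  by (cases p) (auto simp: root_path_def [of "add_root r F"])

lemma root_path_sum:
  assumes F: "rgraph F" and G: "rgraph G" and disj: "verts F \<inter> verts G = {}"
  shows "root_path (graph_sum F G) p \<longleftrightarrow> root_path F p \<or> root_path G p"
proof -
  have "hd p \<in> verts F" if "graph_path F p" for F
    using that by (cases p) (auto simp: graph_path_Cons)
  then show ?thesis
    using rgraphD(5) [OF F] rgraphD(5) [OF G] disj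
    by (auto simp: root_path_def graph_path_sum [OF assms])
qed

section \<open>Leaf-induced subforests\<close>

lemma children_alt:
  "children F v = {w. {v, w} \<in> edges F \<and> (\<exists>p. root_path F p \<and> last p = w \<and> v \<in> set p)}"
  by (simp add: children_def root_path_def conj_assoc)

lemma children_sum:
  assumes F: "rgraph F" and G: "rgraph G" and disj: "verts F \<inter> verts G = {}" and v: "v \<in> verts F"
  shows "children (graph_sum F G) v = children F v"
proof -
  have "{v, w} \<notin> edges G" for w
    using rgraph_edge [OF G] v disj by blast
  moreover have "\<not> (root_path G p \<and> v \<in> set p)" for p
    using root_path_verts [of G p] v disj by blast
  ultimately show ?thesis
    by (auto simp: children_alt root_path_sum [OF F G disj])
qed

lemma graph_sum_commute: "graph_sum F G = graph_sum G F"
  by (auto simp: graph_sum_def)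

lemma leaves_sum:
  assumes "rgraph F" "rgraph G" "verts F \<inter> verts G = {}"
  shows "leaves (graph_sum F G) = leaves F \<union> leaves G"
  using children_sum [OF assms] children_sum [of G F] assms
  by (auto simp: leaves_def graph_sum_commute [of G F] Int_commute)

lemma children_add_root:
  assumes F: "rgraph F" and r: "r \<notin> verts F" and v: "v \<in> verts F"
  shows "children (add_root r F) v = children F v"
proof -
  have "v \<noteq> r"
    using r v by auto
  have *: "last q \<noteq> r" if "root_path F q" for q
    using root_path_verts [OF that] r by auto
  have "(\<exists>p. root_path (add_root r F) p \<and> last p = w \<and> v \<in> set p) \<longleftrightarrow>
      (\<exists>p. root_path F p \<and> last p = w \<and> v \<in> set p)" for w
    using \<open>v \<noteq> r\<close> root_path_verts [of F]
    by (auto simp: root_path_add_root [OF F r])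
  then show ?thesis
    using * \<open>v \<noteq> r\<close> by (auto simp: children_alt doubleton_eq_iff)
qed

lemma children_add_root_root:
  assumes F: "rgraph F" and r: "r \<notin> verts F"
  shows "children (add_root r F) r = roots F"
proof -
  have "root_path (add_root r F) [r, s]" if "s \<in> roots F" for s
    using that rgraphD(5) [OF F] r by (auto simp: root_path_add_root [OF F r] root_path_def graph_path_Cons)
  then have "\<exists>p. root_path (add_root r F) p \<and> last p = s \<and> r \<in> set p" if "s \<in> roots F" for s
    using that by (intro exI [of _ "[r, s]"]) auto
  then show ?thesis
    using add_root_edge [OF F r] by (auto simp: children_alt simp del: add_root_simps(2))
qed

lemma leaves_add_root:
  assumes "rgraph F" "r \<notin> verts F"
  shows "leaves (add_root r F) = (if roots F = {} then {r} else {}) \<union> leaves F"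
  using children_add_root [OF assms] children_add_root_root [OF assms] assms(2)
  by (auto simp: leaves_def)

lemma leaves_subset: "leaves F \<subseteq> verts F"
  by (auto simp: leaves_def)

lemma root_leaf_paths_alt: "root_leaf_paths F = {p. root_path F p \<and> last p \<in> leaves F}"
  by (auto simp: root_leaf_paths_def root_path_def)

lemma root_leaf_paths_sum:
  assumes "rgraph F" "rgraph G" "verts F \<inter> verts G = {}"
  shows "root_leaf_paths (graph_sum F G) = root_leaf_paths F \<union> root_leaf_paths G"
proof -
  have "last p \<notin> leaves G" if "root_path F p" for p
    using root_path_verts [OF that] assms(3) leaves_subset [of G] by blast
  moreover have "last p \<notin> leaves F" if "root_path G p" for p
    using root_path_verts [OF that] assms(3) leaves_subset [of F] by blast
  ultimately show ?thesis
    by (auto simp: root_leaf_paths_alt root_path_sum [OF assms] leaves_sum [OF assms])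
qed

lemma root_leaf_paths_add_root:
  assumes "rgraph F" "r \<notin> verts F"
  shows "root_leaf_paths (add_root r F) =
    (if roots F = {} then {[r]} else (#) r ` root_leaf_paths F)"
proof -
  have "r \<notin> leaves F"
    using assms(2) leaves_subset [of F] by auto
  moreover have "q \<noteq> []" "last q \<noteq> r" if "root_path F q" for q
    using root_path_verts [OF that] assms(2) by auto
  moreover have "roots F \<noteq> {}" if "root_path F q" for q
    using that by (auto simp: root_path_def)
  ultimately show ?thesis
    by (auto simp: root_leaf_paths_alt root_path_add_root [OF assms] leaves_add_root [OF assms])
qed

text \<open>Turns the indexed edge set into a recursion on the list, so that prefixing a root to
  paths becomes \<open>add_root\<close> on their graphs.\<close>

lemma path_graph_Cons: "q \<noteq> [] \<Longrightarrow> path_graph (v # q) = add_root v (path_graph q)"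
proof -
  assume "q \<noteq> []"
  then obtain w q' where q: "q = w # q'"
    by (cases q) auto
  have "{{(v # q) ! i, (v # q) ! Suc i} | i. Suc i < length (v # q)} =
      {{q ! i, q ! Suc i} | i. Suc i < length q} \<union> {{v, s} | s. s \<in> {hd q}}" (is "?L = ?R")
  proof
    show "?L \<subseteq> ?R"
    proof
      fix e assume "e \<in> ?L"
      then obtain i where "e = {(v # q) ! i, (v # q) ! Suc i}" "Suc i < length (v # q)"
        by blast
      then show "e \<in> ?R"
        by (cases i) (auto simp: q)
    qed
    show "?R \<subseteq> ?L"
    proof
      fix e assume "e \<in> ?R"
      then consider "e = {v, hd q}" | i where "e = {q ! i, q ! Suc i}" "Suc i < length q"
        by auto
      then show "e \<in> ?L"
      proof cases
        case 1
        then show ?thesis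
          by (intro CollectI exI [of _ 0]) (simp add: q)
      next
        case (2 i)
        then show ?thesis
          by (intro CollectI exI [of _ "Suc i"]) simp
      qed
    qed
  qed
  then show ?thesis
    by (simp add: path_graph_def add_root_def)
qed

lemma path_graph_single: "path_graph [v] = add_root v null_graph"
  by (simp add: path_graph_def add_root_def)

lemma rgraph_path_graph: "p \<noteq> [] \<Longrightarrow> distinct p \<Longrightarrow> rgraph (path_graph p)"
proof (induction p)
  case (Cons v p)
  then show ?case
    by (cases "p = []")
      (auto simp: path_graph_single path_graph_Cons path_graph_def [of p] intro!: rgraph_add_root)
qed simp

lemma finite_root_leaf_paths:
  assumes "rgraph F"
  shows "finite (root_leaf_paths F)"
proof (rule finite_subset)
  show "root_leaf_paths F \<subseteq> {p. set p \<subseteq> verts F \<and> distinct p}"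
    by (auto simp: root_leaf_paths_def graph_path_def)
  show "finite {p. set p \<subseteq> verts F \<and> distinct p}"
    using assms by (intro finite_subset_distinct rgraphD)
qed

lemma leaf_induced_subforests_alt:
  "leaf_induced_subforests F = (\<lambda>P. graph_union (path_graph ` P)) ` Pow (root_leaf_paths F)"
  by (auto simp: leaf_induced_subforests_def)

lemma finite_leaf_induced_subforests:
  assumes "rgraph F"
  shows "finite (leaf_induced_subforests F)"
proof -
  show ?thesis
    by (simp add: leaf_induced_subforests_alt finite_root_leaf_paths [OF assms])
qed

text \<open>The last property ensures that a new root above a nonempty subforest is not an
  additional leaf.\<close>

lemma leaf_induced_subforest:
  assumes "rgraph F" "A \<in> leaf_induced_subforests F"
  shows "rgraph A" "verts A \<subseteq> verts F" "A \<noteq> null_graph \<Longrightarrow> roots A \<noteq> {}"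
proof -
  obtain P where A: "A = graph_union (path_graph ` P)" and P: "P \<subseteq> root_leaf_paths F"
    using assms(2) by (auto simp: leaf_induced_subforests_def)
  have p: "p \<noteq> []" "distinct p" "set p \<subseteq> verts F" if "p \<in> P" for p
    using that P by (auto simp: root_leaf_paths_def graph_path_def)
  then show "verts A \<subseteq> verts F"
    by (auto simp: A path_graph_def)
  then have "finite (verts A)"
    using assms(1) by (auto dest: rgraphD finite_subset)
  moreover have "rgraph (path_graph p)" if "p \<in> P" for p
    using p [OF that] by (intro rgraph_path_graph)
  ultimately show "rgraph A"
    unfolding A rgraph_def simple_graph_def by fastforce
  show "roots A \<noteq> {}" if "A \<noteq> null_graph"
    using that by (auto simp: A path_graph_def graph_union_empty)
qed

lemma null_leaf_induced_subforest: "null_graph \<in> leaf_induced_subforests F"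
  unfolding leaf_induced_subforests_def
  by (auto intro!: exI [of _ "{}"] simp: graph_union_empty)

text \<open>Restriction recovers a summand of a disjoint sum; this makes the pairing of subforests
  injective and identifies the components of a sum.\<close>

lemma induced_sum:
  assumes "rgraph G" "verts G \<inter> S = {}"
  shows "induced (graph_sum F G) S = induced F S"
proof -
  have "\<not> e \<subseteq> S" if "e \<in> edges G" for e
    using rgraphD(2,4) [OF assms(1) that] assms(2) by blast
  moreover have "roots G \<inter> S = {}"
    using rgraphD(5) [OF assms(1)] assms(2) by blast
  ultimately show ?thesis
    using assms(2) by (auto simp: induced_def)
qed

lemma induced_superset:
  assumes "rgraph F" "verts F \<subseteq> S"
  shows "induced F S = F"
  using assms rgraphD(2,5) [OF assms(1)] by (intro rooted_graph_eqI) (auto simp: induced_def)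

lemma leaf_induced_subforests_sum:
  assumes "rgraph F" "rgraph G" "verts F \<inter> verts G = {}"
  shows "leaf_induced_subforests (graph_sum F G) =
    (\<lambda>(A, B). graph_sum A B) ` (leaf_induced_subforests F \<times> leaf_induced_subforests G)"
proof -
  have "Pow (A \<union> B) = (\<lambda>(P, Q). P \<union> Q) ` (Pow A \<times> Pow B)" for A B :: "'a list set"
  proof
    show "Pow (A \<union> B) \<subseteq> (\<lambda>(P, Q). P \<union> Q) ` (Pow A \<times> Pow B)"
    proof
      fix P assume "P \<in> Pow (A \<union> B)"
      then show "P \<in> (\<lambda>(P, Q). P \<union> Q) ` (Pow A \<times> Pow B)"
        by (intro image_eqI [of _ _ "(P \<inter> A, P \<inter> B)"]) auto
    qed
  qed auto
  then have "leaf_induced_subforests (graph_sum F G) =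
      (\<lambda>P. graph_union (path_graph ` P)) ` (\<lambda>(P, Q). P \<union> Q) `
        (Pow (root_leaf_paths F) \<times> Pow (root_leaf_paths G))"
    by (simp only: leaf_induced_subforests_alt root_leaf_paths_sum [OF assms])
  also have "\<dots> = (\<lambda>(P, Q). graph_sum (graph_union (path_graph ` P)) (graph_union (path_graph ` Q))) `
      (Pow (root_leaf_paths F) \<times> Pow (root_leaf_paths G))"
    unfolding image_image by (intro image_cong refl) (simp add: case_prod_unfold image_Un graph_union_Un)
  also have "\<dots> = (\<lambda>(A, B). graph_sum A B) ` (leaf_induced_subforests F \<times> leaf_induced_subforests G)"
    unfolding leaf_induced_subforests_alt image_paired_Times [symmetric] image_image
    by (simp only: case_prod_unfold fst_conv snd_conv)
  finally show ?thesis .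
qed

lemma P_poly_sum:
  assumes F: "rgraph F" and G: "rgraph G" and disj: "verts F \<inter> verts G = {}"
  shows "P_poly (graph_sum F G) = P_poly F * P_poly G"
proof -
  let ?m = "\<lambda>A. var_x ^ card (verts A) * var_y ^ card (leaves A)"
  have sub: "rgraph A" "rgraph B" "verts A \<inter> verts B = {}" "verts A \<subseteq> verts F" "verts B \<subseteq> verts G"
    if "A \<in> leaf_induced_subforests F" "B \<in> leaf_induced_subforests G" for A B
    using that leaf_induced_subforest [OF F] leaf_induced_subforest [OF G] disj by blast+
  have "inj_on (\<lambda>(A, B). graph_sum A B) (leaf_induced_subforests F \<times> leaf_induced_subforests G)"
  proof (rule inj_on_inverseI)
    fix AB assume "AB \<in> leaf_induced_subforests F \<times> leaf_induced_subforests G"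
    then obtain A B where AB: "AB = (A, B)" "A \<in> leaf_induced_subforests F" "B \<in> leaf_induced_subforests G"
      by auto
    have "induced (graph_sum A B) (verts F) = A"
      using sub [OF AB(2,3)] disj by (subst induced_sum) (auto intro: induced_superset)
    moreover have "induced (graph_sum A B) (verts G) = B"
      unfolding graph_sum_commute [of A B] using sub [OF AB(2,3)] disj
      by (subst induced_sum) (auto intro: induced_superset)
    ultimately show "(\<lambda>H. (induced H (verts F), induced H (verts G))) (case AB of (A, B) \<Rightarrow> graph_sum A B) = AB"
      by (simp add: AB)
  qed
  then have "P_poly (graph_sum F G) =
      (\<Sum>(A, B)\<in>leaf_induced_subforests F \<times> leaf_induced_subforests G. ?m (graph_sum A B))"
    unfolding P_poly_def leaf_induced_subforests_sum [OF assms]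
    by (subst sum.reindex) (simp_all add: case_prod_unfold comp_def)
  also have "\<dots> = (\<Sum>(A, B)\<in>leaf_induced_subforests F \<times> leaf_induced_subforests G. ?m A * ?m B)"
  proof (intro sum.cong refl, clarsimp)
    fix A B assume *: "A \<in> leaf_induced_subforests F" "B \<in> leaf_induced_subforests G"
    note s = sub [OF *]
    have "card (verts A \<union> verts B) = card (verts A) + card (verts B)"
      using s by (intro card_Un_disjoint rgraphD) auto
    moreover have "card (leaves (graph_sum A B)) = card (leaves A) + card (leaves B)"
      unfolding leaves_sum [OF s(1-3)] using s leaves_subset [of A] leaves_subset [of B]
      by (intro card_Un_disjoint) (auto intro: finite_subset rgraphD)
    ultimately show "var_x ^ card (verts A \<union> verts B) * var_y ^ card (leaves (graph_sum A B)) =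
        ?m A * ?m B"
      by (simp add: power_add algebra_simps)
  qed
  also have "\<dots> = P_poly F * P_poly G"
    unfolding P_poly_def sum_product by (rule sum.cartesian_product [symmetric])
  finally show ?thesis .
qed

lemma graph_union_add_root:
  assumes "\<G> \<noteq> {}"
  shows "graph_union (add_root r ` \<G>) = add_root r (graph_union \<G>)"
  using assms by (auto simp: graph_union_def add_root_def)

text \<open>Prefixing \<open>r\<close> to all chosen paths adds the root to their union, except for
  the empty choice, whose union stays the null graph instead of becoming a lone root. This exception
  is the source of the summand \<open>1 - x\<close>.\<close>

lemma leaf_induced_subforests_add_root:
  assumes "rgraph F" "r \<notin> verts F" "roots F \<noteq> {}"
  shows "leaf_induced_subforests (add_root r F) =
    insert null_graph (add_root r ` (leaf_induced_subforests F - {null_graph}))"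
proof -
  have "graph_union (path_graph ` ((#) r ` P)) =
      (if P = {} then null_graph else add_root r (graph_union (path_graph ` P)))"
    if "P \<subseteq> root_leaf_paths F" for P
  proof -
    have "path_graph ` ((#) r ` P) = add_root r ` (path_graph ` P)"
      unfolding image_image using that
      by (intro image_cong refl path_graph_Cons) (auto simp: root_leaf_paths_def)
    then show ?thesis
      by (auto simp: graph_union_empty graph_union_add_root)
  qed
  moreover have null: "graph_union (path_graph ` P) = null_graph \<longleftrightarrow> P = {}" if "P \<subseteq> root_leaf_paths F" for P
  proof
    assume "graph_union (path_graph ` P) = null_graph"
    then have "roots (graph_union (path_graph ` P)) = {}"
      by simp
    then show "P = {}"
      by (auto simp: path_graph_def)
  qed (simp add: graph_union_empty)
  moreover have "Pow (root_leaf_paths (add_root r F)) = image ((#) r) ` Pow (root_leaf_paths F)"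
    using assms by (simp add: root_leaf_paths_add_root image_Pow_surj)
  ultimately have "leaf_induced_subforests (add_root r F) =
      (\<lambda>P. if P = {} then null_graph else add_root r (graph_union (path_graph ` P))) ` Pow (root_leaf_paths F)"
    by (simp add: leaf_induced_subforests_alt image_image cong: image_cong_simp)
  also have "\<dots> = insert null_graph
      (add_root r ` (\<lambda>P. graph_union (path_graph ` P)) ` (Pow (root_leaf_paths F) - {{}}))"
    by (auto simp: image_iff)
  also have "(\<lambda>P. graph_union (path_graph ` P)) ` (Pow (root_leaf_paths F) - {{}}) =
      leaf_induced_subforests F - {null_graph}"
    using null by (auto simp: leaf_induced_subforests_alt)
  finally show ?thesis .
qed

lemma leaves_null [simp]: "leaves null_graph = {}"
  by (simp add: leaves_def)

lemma P_poly_null [simp]: "P_poly (null_graph :: 'a rooted_graph) = 1"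
proof -
  have "root_leaf_paths (null_graph :: 'a rooted_graph) = {}"
    by (auto simp: root_leaf_paths_def)
  then have "leaf_induced_subforests (null_graph :: 'a rooted_graph) = {null_graph}"
    by (simp add: leaf_induced_subforests_alt graph_union_empty)
  then show ?thesis
    by (simp add: P_poly_def)
qed

lemma P_poly_add_root:
  assumes F: "rgraph F" and r: "r \<notin> verts F"
  shows "P_poly (add_root r F) = 1 + var_x * ((if roots F = {} then 1 + var_y else P_poly F) - 1)"
proof (cases "roots F = {}")
  case True
  \<comment> \<open>If \<open>F\<close> has no roots, the only path from the root to a leaf is
    \<open>[r]\<close>, chosen or not.\<close>
  have "leaf_induced_subforests (add_root r F) = {null_graph, add_root r null_graph}"
    using True
    by (auto simp: leaf_induced_subforests_def root_leaf_paths_add_root [OF assms] subset_singleton_iff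
        graph_union_empty graph_union_insert path_graph_single intro: exI [of _ "{[r]}"] exI [of _ "{}"])
  moreover have "null_graph \<noteq> add_root r null_graph"
    by (simp add: null_graph_def add_root_def)
  ultimately show ?thesis
    using True by (simp add: P_poly_def leaves_add_root)
next
  case False
  let ?L = "leaf_induced_subforests F - {null_graph}"
  let ?m = "\<lambda>A. var_x ^ card (verts A) * var_y ^ card (leaves A)"
  have fin: "finite ?L"
    using finite_leaf_induced_subforests [OF F] by simp
  have sub: "rgraph A" "verts A \<subseteq> verts F" "roots A \<noteq> {}" "r \<notin> verts A" if "A \<in> ?L" for A
    using that leaf_induced_subforest [OF F, of A] r by auto
  have inj: "inj_on (add_root r) ?L"
  proof (rule inj_onI)
    fix A B assume A: "A \<in> ?L" and B: "B \<in> ?L" and eq: "add_root r A = add_root r B"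
    \<comment> \<open>As \<open>r\<close> lies outside \<open>H\<close>, deleting it restores
      \<open>H\<close>, and its neighbours are the former roots.\<close>
    have *: "verts H = verts (add_root r H) - {r}" "edges H = {e \<in> edges (add_root r H). r \<notin> e}"
      "roots H = {s. {r, s} \<in> edges (add_root r H)}" if "H \<in> ?L" for H
      using sub(4) [OF that] rgraphD(2) [OF sub(1) [OF that]]
      by (auto simp only: add_root_edge [OF sub(1) [OF that] sub(4) [OF that]]) auto
    show "A = B"
      using * [OF A] * [OF B] unfolding eq
      by (intro rooted_graph_eqI) (simp_all only:)
  qed
  have "null_graph \<notin> add_root r ` ?L"
    by (auto simp: null_graph_def add_root_def)
  then have "P_poly (add_root r F) = 1 + (\<Sum>A\<in>?L. ?m (add_root r A))"
    unfolding P_poly_def leaf_induced_subforests_add_root [OF assms False]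
    using fin inj by (subst sum.insert) (auto simp: sum.reindex)
  also have "(\<Sum>A\<in>?L. ?m (add_root r A)) = (\<Sum>A\<in>?L. var_x * ?m A)"
  proof (intro sum.cong refl)
    fix A assume "A \<in> ?L"
    note A = sub [OF this]
    have "card (insert r (verts A)) = Suc (card (verts A))"
      using A rgraphD(1) [OF A(1)] by simp
    then show "?m (add_root r A) = var_x * ?m A"
      using A by (simp add: leaves_add_root algebra_simps)
  qed
  \<comment> \<open>The null graph contributes \<open>1\<close> to \<open>P_poly F\<close> and was
    left out of the sum.\<close>
  also have "\<dots> = var_x * (P_poly F - 1)"
    using finite_leaf_induced_subforests [OF F] null_leaf_induced_subforest [of F]
    by (simp add: P_poly_def sum_diff1 flip: sum_distrib_left)
  finally show ?thesis
    using False by simp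
qed

section \<open>Subtrees\<close>

text \<open>
  Subtrees and their boundaries for forests: a root-closed set meets every component in a subtree,
  and its boundary contains the root of every component it misses.
\<close>

definition root_closed :: "'a rooted_graph \<Rightarrow> 'a set \<Rightarrow> bool" where
  "root_closed F S \<longleftrightarrow> (\<forall>v\<in>S. \<exists>p. root_path F p \<and> last p = v \<and> set p \<subseteq> S)"

definition forest_boundary :: "'a rooted_graph \<Rightarrow> 'a set \<Rightarrow> 'a set" where
  "forest_boundary F S = {v \<in> verts F - S. v \<in> roots F \<or> (\<exists>u\<in>S. {u, v} \<in> edges F)}"

text \<open>Deleting a root turns the sum over subtrees into one sum over the whole forest below it,
  whereas \<open>S_poly\<close> is a product over components. This is the sum form; the two are
  shown equal later.\<close>

definition S_forest :: "'a rooted_graph \<Rightarrow> int poly poly" where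
  "S_forest F = (\<Sum>S | root_closed F S. var_x ^ card S * var_y ^ card (forest_boundary F S))"

lemma root_closed_subset: "root_closed F S \<Longrightarrow> S \<subseteq> verts F"
  unfolding root_closed_def by (auto dest: root_path_verts)

lemma root_closed_empty [simp]: "root_closed F {}"
  by (simp add: root_closed_def)

lemma finite_root_closed:
  assumes "rgraph F"
  shows "finite {S. root_closed F S}"
proof (rule finite_subset)
  show "{S. root_closed F S} \<subseteq> Pow (verts F)"
    using root_closed_subset by blast
  show "finite (Pow (verts F))"
    using rgraphD(1) [OF assms] by simp
qed

lemma root_closed_sum:
  assumes F: "rgraph F" and G: "rgraph G" and disj: "verts F \<inter> verts G = {}"
  shows "{S. root_closed (graph_sum F G) S} =
    (\<lambda>(A, B). A \<union> B) ` ({A. root_closed F A} \<times> {B. root_closed G B})"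
proof
  note path = root_path_sum [OF assms]
  show "{S. root_closed (graph_sum F G) S} \<subseteq>
    (\<lambda>(A, B). A \<union> B) ` ({A. root_closed F A} \<times> {B. root_closed G B})"
  proof
    fix S assume "S \<in> {S. root_closed (graph_sum F G) S}"
    then have S: "root_closed (graph_sum F G) S"
      by simp
    have "root_closed F (S \<inter> verts F)"
      unfolding root_closed_def
    proof
      fix v assume v: "v \<in> S \<inter> verts F"
      then obtain p where p: "root_path F p \<or> root_path G p" "last p = v" "set p \<subseteq> S"
        using S by (auto simp: root_closed_def path)
      then have "root_path F p"
        using root_path_verts [of G p] v disj by auto
      then show "\<exists>p. root_path F p \<and> last p = v \<and> set p \<subseteq> S \<inter> verts F"
        using p root_path_verts [of F p] by blast
    qed
    moreover have "root_closed G (S \<inter> verts G)"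
      unfolding root_closed_def
    proof
      fix v assume v: "v \<in> S \<inter> verts G"
      then obtain p where p: "root_path F p \<or> root_path G p" "last p = v" "set p \<subseteq> S"
        using S by (auto simp: root_closed_def path)
      then have "root_path G p"
        using root_path_verts [of F p] v disj by auto
      then show "\<exists>p. root_path G p \<and> last p = v \<and> set p \<subseteq> S \<inter> verts G"
        using p root_path_verts [of G p] by blast
    qed
    ultimately show "S \<in> (\<lambda>(A, B). A \<union> B) ` ({A. root_closed F A} \<times> {B. root_closed G B})"
      using root_closed_subset [OF S]
      by (intro image_eqI [of _ _ "(S \<inter> verts F, S \<inter> verts G)"]) auto
  qed
  have "root_closed (graph_sum F G) (A \<union> B)" if "root_closed F A" "root_closed G B" for A B
    using that unfolding root_closed_def path by blast
  then show "(\<lambda>(A, B). A \<union> B) ` ({A. root_closed F A} \<times> {B. root_closed G B}) \<subseteq>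
      {S. root_closed (graph_sum F G) S}"
    by auto
qed

lemma forest_boundary_sum:
  assumes F: "rgraph F" and G: "rgraph G" and disj: "verts F \<inter> verts G = {}"
    and "A \<subseteq> verts F" "B \<subseteq> verts G"
  shows "forest_boundary (graph_sum F G) (A \<union> B) = forest_boundary F A \<union> forest_boundary G B"
  using assms(3-5) rgraphD(5) [OF F] rgraphD(5) [OF G] rgraph_edge [OF F] rgraph_edge [OF G]
  unfolding forest_boundary_def graph_sum_simps by blast

lemma S_forest_sum:
  assumes F: "rgraph F" and G: "rgraph G" and disj: "verts F \<inter> verts G = {}"
  shows "S_forest (graph_sum F G) = S_forest F * S_forest G"
proof -
  let ?m = "\<lambda>F A. var_x ^ card A * var_y ^ card (forest_boundary F A)"
  have "inj_on (\<lambda>(A, B). A \<union> B) ({A. root_closed F A} \<times> {B. root_closed G B})"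
  proof (rule inj_on_inverseI)
    fix AB assume "AB \<in> {A. root_closed F A} \<times> {B. root_closed G B}"
    then obtain A B where AB: "AB = (A, B)" "A \<subseteq> verts F" "B \<subseteq> verts G"
      using root_closed_subset by blast
    then have "(A \<union> B) \<inter> verts F = A" "(A \<union> B) \<inter> verts G = B"
      using disj by blast+
    then show "(\<lambda>S. (S \<inter> verts F, S \<inter> verts G)) (case AB of (A, B) \<Rightarrow> A \<union> B) = AB"
      by (simp add: AB(1))
  qed
  then have "S_forest (graph_sum F G) =
      (\<Sum>(A, B)\<in>{A. root_closed F A} \<times> {B. root_closed G B}. ?m (graph_sum F G) (A \<union> B))"
    unfolding S_forest_def root_closed_sum [OF assms]
    by (subst sum.reindex) (simp_all add: case_prod_unfold comp_def)
  also have "\<dots> = (\<Sum>(A, B)\<in>{A. root_closed F A} \<times> {B. root_closed G B}. ?m F A * ?m G B)"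
  proof (intro sum.cong refl, clarsimp)
    fix A B assume *: "root_closed F A" "root_closed G B"
    note sub = root_closed_subset [OF *(1)] root_closed_subset [OF *(2)]
    have fin: "finite (verts F)" "finite (verts G)"
      using F G by (simp_all add: rgraphD)
    have "card (A \<union> B) = card A + card B"
      using sub fin disj by (intro card_Un_disjoint) (auto intro: finite_subset)
    moreover have "forest_boundary F A \<subseteq> verts F" "forest_boundary G B \<subseteq> verts G"
      by (auto simp: forest_boundary_def)
    then have "card (forest_boundary F A \<union> forest_boundary G B) =
        card (forest_boundary F A) + card (forest_boundary G B)"
      using fin disj by (intro card_Un_disjoint) (auto intro: finite_subset)
    ultimately show "?m (graph_sum F G) (A \<union> B) = ?m F A * ?m G B"
      using sub by (simp add: forest_boundary_sum [OF assms] power_add algebra_simps)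
  qed
  also have "\<dots> = S_forest F * S_forest G"
    unfolding S_forest_def sum_product by (rule sum.cartesian_product [symmetric])
  finally show ?thesis .
qed

lemma root_closed_insert_root:
  assumes "rgraph F" "r \<notin> verts F" "root_closed F S"
  shows "root_closed (add_root r F) (insert r S)"
  unfolding root_closed_def
proof
  fix v assume "v \<in> insert r S"
  then consider "v = r" | "v \<in> S"
    by auto
  then show "\<exists>p. root_path (add_root r F) p \<and> last p = v \<and> set p \<subseteq> insert r S"
  proof cases
    case 1
    then show ?thesis
      by (intro exI [of _ "[r]"]) (simp add: root_path_add_root [OF assms(1,2)])
  next
    case 2
    then obtain p where p: "root_path F p" "last p = v" "set p \<subseteq> S"
      using assms(3) by (auto simp: root_closed_def)
    then show ?thesis
      using root_path_verts [OF p(1)]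
      by (intro exI [of _ "r # p"]) (auto simp: root_path_add_root [OF assms(1,2)])
  qed
qed

lemma root_closed_add_root_root:
  assumes "rgraph F" "r \<notin> verts F" "root_closed (add_root r F) S" "S \<noteq> {}"
  shows "r \<in> S"
proof -
  obtain v p where "root_path (add_root r F) p" "set p \<subseteq> S"
    using assms(3,4) unfolding root_closed_def by blast
  then show ?thesis
    by (auto simp: root_path_add_root [OF assms(1,2)])
qed

lemma root_closed_add_root:
  assumes F: "rgraph F" and r: "r \<notin> verts F"
  shows "{S. root_closed (add_root r F) S} = insert {} (insert r ` {S. root_closed F S})"
proof
  show "{S. root_closed (add_root r F) S} \<subseteq> insert {} (insert r ` {S. root_closed F S})"
  proof
    fix S assume "S \<in> {S. root_closed (add_root r F) S}"
    then have S: "root_closed (add_root r F) S"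
      by simp
    have "S \<in> insert r ` {S. root_closed F S}" if "S \<noteq> {}"
    proof
      show "S = insert r (S - {r})"
        using root_closed_add_root_root [OF assms S that] by auto
      have "root_closed F (S - {r})"
        unfolding root_closed_def
      proof
        fix v assume v: "v \<in> S - {r}"
        then obtain p where p: "root_path (add_root r F) p" "last p = v" "set p \<subseteq> S"
          using S by (auto simp: root_closed_def)
        \<comment> \<open>The alternative \<open>p = [r]\<close> is excluded, since \<open>v\<close>
          differs from \<open>r\<close>.\<close>
        then obtain q where q: "p = r # q" "root_path F q"
          using v by (auto simp: root_path_add_root [OF assms])
        then show "\<exists>p. root_path F p \<and> last p = v \<and> set p \<subseteq> S - {r}"
          using p root_path_verts [OF q(2)] r by (intro exI [of _ q]) auto
      qed
      then show "S - {r} \<in> {S. root_closed F S}"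
        by simp
    qed
    then show "S \<in> insert {} (insert r ` {S. root_closed F S})"
      by auto
  qed
qed (auto intro: root_closed_insert_root [OF assms])

text \<open>The roots of \<open>F\<close> missed by \<open>S\<close> are outside neighbours of
  \<open>r\<close>. Counting missed roots in the boundary of a forest anticipates exactly
  this.\<close>

lemma forest_boundary_add_root:
  assumes F: "rgraph F" and r: "r \<notin> verts F" and S: "S \<subseteq> verts F"
  shows "forest_boundary (add_root r F) (insert r S) = forest_boundary F S"
proof -
  have "{u, v} \<in> edges (add_root r F) \<longleftrightarrow> {u, v} \<in> edges F" if "u \<in> S" "v \<in> verts F" for u v
    using that S r by (auto simp: doubleton_eq_iff)
  then show ?thesis
    using r add_root_edge [OF F r] by (auto simp: forest_boundary_def simp del: add_root_simps(2))
qed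

lemma S_forest_add_root:
  assumes F: "rgraph F" and r: "r \<notin> verts F"
  shows "S_forest (add_root r F) = var_y + var_x * S_forest F"
proof -
  let ?m = "\<lambda>F A. var_x ^ card A * var_y ^ card (forest_boundary F A)"
  have sub: "finite S" "r \<notin> S" "S \<subseteq> verts F" if "root_closed F S" for S
    using root_closed_subset [OF that] r rgraphD(1) [OF F] by (auto intro: finite_subset)
  have inj: "inj_on (insert r) {S. root_closed F S}"
    using sub(2) by (intro inj_onI) (auto simp: insert_ident)
  have "S_forest (add_root r F) =
      ?m (add_root r F) {} + (\<Sum>S | root_closed F S. ?m (add_root r F) (insert r S))"
    unfolding S_forest_def root_closed_add_root [OF assms]
    using inj finite_root_closed [OF F] by (subst sum.insert) (auto simp: sum.reindex)
  also have "forest_boundary (add_root r F) {} = {r}"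
    by (auto simp: forest_boundary_def)
  also have "(\<Sum>S | root_closed F S. ?m (add_root r F) (insert r S)) = (\<Sum>S | root_closed F S. var_x * ?m F S)"
    using sub by (intro sum.cong refl) (simp add: forest_boundary_add_root [OF assms] algebra_simps)
  finally show ?thesis
    by (simp add: S_forest_def sum_distrib_left)
qed

lemma connected_induced:
  assumes "r \<in> S" and "\<And>v. v \<in> S \<Longrightarrow> \<exists>p. graph_path G p \<and> hd p = r \<and> last p = v \<and> set p \<subseteq> S"
  shows "connected_graph (induced G S)"
proof -
  have "linked (induced G S) r v" if "v \<in> S" for v
    using assms(2) [OF that] by (auto simp: linked_def graph_path_induced)
  moreover from this have "r \<in> verts (induced G S)"
    using linked_verts assms(1) by fast
  ultimately show ?thesis
    unfolding connected_graph_def by (auto simp: induced_def intro: linked_sym linked_trans)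
qed

lemma subtrees_add_root:
  assumes F: "rgraph F" and r: "r \<notin> verts F"
  shows "subtrees (add_root r F) = {S. root_closed (add_root r F) S}"
proof -
  let ?T = "add_root r F"
  have "root_closed ?T S" if "r \<in> S" "S \<subseteq> verts ?T" "connected_graph (induced ?T S)" for S
    unfolding root_closed_def
  proof
    fix v assume "v \<in> S"
    then have "linked (induced ?T S) r v"
      using that by (auto simp: connected_graph_def induced_def simp del: add_root_simps)
    then show "\<exists>p. root_path ?T p \<and> last p = v \<and> set p \<subseteq> S"
      by (auto simp: linked_def graph_path_induced root_path_def)
  qed
  moreover have "connected_graph (induced ?T S)" if "root_closed ?T S" "S \<noteq> {}" for S
  proof (rule connected_induced)
    show "r \<in> S"
      by (rule root_closed_add_root_root [OF assms that])
    show "\<exists>p. graph_path ?T p \<and> hd p = r \<and> last p = v \<and> set p \<subseteq> S" if "v \<in> S" for v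
      using \<open>root_closed ?T S\<close> that by (auto simp: root_closed_def root_path_def)
  qed
  ultimately show ?thesis
    using root_closed_add_root_root [OF assms] root_closed_subset [of ?T]
    by (auto simp: subtrees_def simp del: add_root_simps(1)) blast
qed

text \<open>Both boundaries of the empty set are \<open>{r}\<close>; a nonempty root-closed set
  contains \<open>r\<close>, so both consist of the outside neighbours.\<close>

lemma S_tree_add_root:
  assumes F: "rgraph F" and r: "r \<notin> verts F"
  shows "S_tree (add_root r F) = S_forest (add_root r F)"
proof -
  have "boundary (add_root r F) S = forest_boundary (add_root r F) S"
    if "root_closed (add_root r F) S" for S
    using root_closed_add_root_root [OF assms that]
    by (auto simp: boundary_def forest_boundary_def simp del: add_root_simps(2))
  then show ?thesis
    unfolding S_tree_def S_forest_def subtrees_add_root [OF assms] by (intro sum.cong) auto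
qed

section \<open>Connected components and the product over them\<close>

lemma linked_sum:
  assumes "rgraph F" "rgraph G" "verts F \<inter> verts G = {}" "v \<in> verts F"
  shows "linked (graph_sum F G) v w \<longleftrightarrow> linked F v w"
proof -
  have "\<not> (graph_path G p \<and> hd p = v)" for p
    using assms(3,4) by (cases p) (auto simp: graph_path_Cons)
  then show ?thesis
    by (auto simp: linked_def graph_path_sum [OF assms(1-3)])
qed

lemma graph_components_sum:
  assumes F: "rgraph F" and G: "rgraph G" and disj: "verts F \<inter> verts G = {}"
  shows "graph_components (graph_sum F G) = graph_components F \<union> graph_components G"
proof -
  have *: "(\<lambda>v. induced (graph_sum F G) {w. linked (graph_sum F G) v w}) ` verts F = graph_components F"
    if F: "rgraph F" and G: "rgraph G" and disj: "verts F \<inter> verts G = {}" for F G :: "'a rooted_graph"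
    unfolding graph_components_def
  proof (intro image_cong refl)
    fix v assume "v \<in> verts F"
    then have "verts G \<inter> {w. linked F v w} = {}"
      using disj linked_verts [of F v] by blast
    then show "induced (graph_sum F G) {w. linked (graph_sum F G) v w} = induced F {w. linked F v w}"
      by (simp add: linked_sum [OF F G disj \<open>v \<in> verts F\<close>] induced_sum [OF G])
  qed
  show ?thesis
    using * [OF F G disj] * [OF G F] disj
    by (simp add: graph_components_def [of "graph_sum F G"] image_Un graph_sum_commute [of G F] Int_commute)
qed

lemma graph_component_verts:
  assumes "C \<in> graph_components F"
  shows "verts C \<noteq> {} \<and> verts C \<subseteq> verts F"
proof -
  obtain v where "v \<in> verts F" "C = induced F {w. linked F v w}"
    using assms by (auto simp: graph_components_def)
  then have "v \<in> verts C" "verts C \<subseteq> verts F"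
    by (simp_all add: induced_def linked_refl)
  then show ?thesis
    by blast
qed

text \<open>The product runs over a set of graphs. Components are nonempty and those of
  \<open>F\<close> and \<open>G\<close> lie in disjoint vertex sets, so none coincide, even if
  isomorphic, and no factor is lost.\<close>

lemma S_poly_sum:
  assumes F: "rgraph F" and G: "rgraph G" and disj: "verts F \<inter> verts G = {}"
  shows "S_poly (graph_sum F G) = S_poly F * S_poly G"
proof -
  have "graph_components F \<inter> graph_components G = {}"
    using graph_component_verts [of _ F] graph_component_verts [of _ G] disj by fastforce
  moreover have "finite (graph_components F)" "finite (graph_components G)"
    using F G by (simp_all add: graph_components_def rgraphD)
  ultimately show ?thesis
    unfolding S_poly_def graph_components_sum [OF assms] by (intro prod.union_disjoint)
qed

text \<open>By \<open>closed\<close> every vertex of \<open>F\<close> is reached from one of its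
  roots, so the new graph is connected and is its own single component.\<close>

lemma S_poly_add_root:
  assumes F: "rgraph F" and r: "r \<notin> verts F" and closed: "root_closed F (verts F)"
  shows "S_poly (add_root r F) = var_y + var_x * S_forest F"
proof -
  let ?T = "add_root r F"
  have "root_closed ?T (verts ?T)"
    using root_closed_insert_root [OF assms] by simp
  then have *: "linked ?T r v" if "v \<in> verts ?T" for v
    using that unfolding root_closed_def linked_def root_path_def by (auto simp del: add_root_simps(1,2))
  have "{w. linked ?T v w} = verts ?T" if "v \<in> verts ?T" for v
    using linked_trans [OF linked_sym [OF * [OF that]] *] linked_verts [of ?T v] by auto
  moreover have "induced ?T (verts ?T) = ?T"
    by (intro induced_superset rgraph_add_root F r order_refl)
  ultimately have "graph_components ?T = (\<lambda>v. ?T) ` verts ?T"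
    unfolding graph_components_def by (intro image_cong refl) simp
  then have "graph_components ?T = {?T}"
    by auto
  then show ?thesis
    by (simp add: S_poly_def S_tree_add_root [OF F r] S_forest_add_root [OF F r])
qed

section \<open>Shapes of rooted forests\<close>

text \<open>A derivation builds the forest tree by tree from disjoint pieces, in an order that the
  multiset forgets. The recursions for sums and new roots apply along it.\<close>

inductive has_shape :: "'a rooted_graph \<Rightarrow> shape multiset \<Rightarrow> bool" where
  null: "has_shape null_graph {#}"
| sum: "has_shape G N \<Longrightarrow> has_shape F M \<Longrightarrow> r \<notin> verts G \<Longrightarrow> verts (add_root r G) \<inter> verts F = {} \<Longrightarrow>
    has_shape (graph_sum (add_root r G) F) (add_mset (Node N) M)"

lemma has_shape_rgraph: "has_shape F M \<Longrightarrow> rgraph F"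
  by (induction rule: has_shape.induct) (auto intro: rgraph_sum rgraph_add_root)

lemma has_shape_roots: "has_shape F M \<Longrightarrow> roots F = {} \<longleftrightarrow> M = {#}"
  by (induction rule: has_shape.induct) auto

lemma has_shape_root_closed: "has_shape F M \<Longrightarrow> root_closed F (verts F)"
proof (induction rule: has_shape.induct)
  case (sum G N F M r)
  have "rgraph (add_root r G)" "rgraph F"
    using sum by (auto intro: rgraph_add_root has_shape_rgraph)
  moreover have "root_closed (add_root r G) (verts (add_root r G))"
    using sum root_closed_insert_root [OF has_shape_rgraph [of G]] by auto
  ultimately have "verts (add_root r G) \<union> verts F \<in> {S. root_closed (graph_sum (add_root r G) F) S}"
    unfolding root_closed_sum [OF \<open>rgraph (add_root r G)\<close> \<open>rgraph F\<close> sum.hyps(4)]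
    using sum.IH(2) by (intro image_eqI [of _ _ "(verts (add_root r G), verts F)"]) auto
  then show ?case
    by simp
qed simp

lemma has_shape_P_poly:
  "has_shape F M \<Longrightarrow> P_poly F = prod_mset (image_mset (P_shape var_x var_y) M)"
proof (induction rule: has_shape.induct)
  case (sum G N F M r)
  then have G: "rgraph G" and F: "rgraph F"
    by (auto intro: has_shape_rgraph)
  show ?case
    using sum.IH has_shape_roots [OF sum.hyps(1)]
    by (simp add: P_poly_sum [OF rgraph_add_root [OF G sum.hyps(3)] F sum.hyps(4)] P_poly_add_root [OF G sum.hyps(3)])
qed simp

lemma S_poly_null [simp]: "S_poly null_graph = 1"
  by (simp add: S_poly_def graph_components_def)

lemma S_forest_null [simp]: "S_forest (null_graph :: 'a rooted_graph) = 1"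
proof -
  have "{S. root_closed (null_graph :: 'a rooted_graph) S} = {{}}"
    using root_closed_subset [of "null_graph :: 'a rooted_graph"] by auto
  then show ?thesis
    by (simp add: S_forest_def forest_boundary_def)
qed

text \<open>The two equations are proved together: the recursion at a root produces
  \<open>S_forest\<close> of the part below, while the product formula is known for its
  \<open>S_poly\<close>.\<close>

lemma has_shape_S_poly:
  "has_shape F M \<Longrightarrow> S_poly F = prod_mset (image_mset (S_shape var_x var_y) M) \<and> S_poly F = S_forest F"
proof (induction rule: has_shape.induct)
  case (sum G N F M r)
  then have G: "rgraph G" and F: "rgraph F"
    by (auto intro: has_shape_rgraph)
  note T = rgraph_add_root [OF G sum.hyps(3)] F sum.hyps(4)
  show ?case
    using sum.IH S_poly_add_root [OF G sum.hyps(3) has_shape_root_closed [OF sum.hyps(1)]]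
    by (simp add: S_poly_sum [OF T] S_forest_sum [OF T] S_forest_add_root [OF G sum.hyps(3)])
qed simp

section \<open>Transport along vertex maps and isomorphism\<close>

definition image_graph :: "('a \<Rightarrow> 'b) \<Rightarrow> 'a rooted_graph \<Rightarrow> 'b rooted_graph" where
  "image_graph f F = \<lparr>verts = f ` verts F, edges = image f ` edges F, roots = f ` roots F\<rparr>"

lemma image_graph_simps [simp]:
  "verts (image_graph f F) = f ` verts F" "edges (image_graph f F) = image f ` edges F"
  "roots (image_graph f F) = f ` roots F"
  by (simp_all add: image_graph_def)

lemma image_graph_null [simp]: "image_graph f null_graph = null_graph"
  by (simp add: image_graph_def null_graph_def)

lemma image_graph_sum [simp]:
  "image_graph f (graph_sum F G) = graph_sum (image_graph f F) (image_graph f G)"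
  by (simp add: image_graph_def graph_sum_def image_Un)

lemma image_graph_add_root [simp]:
  "image_graph f (add_root r F) = add_root (f r) (image_graph f F)"
  by (simp add: image_graph_def add_root_def image_Un setcompr_eq_image image_image)

lemma image_graph_cong:
  assumes "rgraph F" "\<And>v. v \<in> verts F \<Longrightarrow> f v = g v"
  shows "image_graph f F = image_graph g F"
proof (rule rooted_graph_eqI)
  show "edges (image_graph f F) = edges (image_graph g F)"
    unfolding image_graph_simps using assms(2) rgraphD(2) [OF assms(1)]
    by (intro image_cong refl) blast
  show "roots (image_graph f F) = roots (image_graph g F)"
    unfolding image_graph_simps using assms(2) rgraphD(5) [OF assms(1)]
    by (intro image_cong refl) blast
qed (simp add: assms(2))

text \<open>An injective map carries a whole derivation along, so isomorphic forests share a shape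
  and hence their polynomials.\<close>

lemma has_shape_image:
  assumes "has_shape F M" "inj_on f (verts F)"
  shows "has_shape (image_graph f F) M"
  using assms
proof (induction rule: has_shape.induct)
  case (sum G N F M r)
  then have *: "inj_on f (verts G)" "inj_on f (verts F)"
    by (auto simp: inj_on_Un)
  have "f r \<notin> verts (image_graph f G)" "verts (add_root (f r) (image_graph f G)) \<inter> verts (image_graph f F) = {}"
    using sum.prems sum.hyps(3,4) by (auto simp: inj_on_def)
  then show ?case
    using sum.IH * by (simp add: has_shape.sum)
qed (simp add: has_shape.null)

text \<open>Edges are two-element sets of vertices, so agreement on adjacency determines the edge
  set and an isomorphism becomes an equation between graphs.\<close>

lemma rooted_iso_iff:
  assumes F: "rgraph F" and G: "rgraph G"
  shows "rooted_iso F G \<longleftrightarrow> (\<exists>f. inj_on f (verts F) \<and> G = image_graph f F)"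
proof
  assume "rooted_iso F G"
  then obtain f where f: "bij_betw f (verts F) (verts G)" "f ` roots F = roots G"
    and edge: "\<And>u v. u \<in> verts F \<Longrightarrow> v \<in> verts F \<Longrightarrow> {u, v} \<in> edges F \<longleftrightarrow> {f u, f v} \<in> edges G"
    by (auto simp: rooted_iso_def)
  have "edges G = image f ` edges F"
  proof (intro equalityI subsetI)
    fix e assume e: "e \<in> edges G"
    then obtain a b where "e = {a, b}"
      using rgraphD(3) [OF G e] by (auto simp: card_2_iff)
    moreover have "a \<in> f ` verts F" "b \<in> f ` verts F"
      using rgraphD(2) [OF G e] f(1) \<open>e = {a, b}\<close> by (auto simp: bij_betw_def)
    ultimately obtain u v where "e = {f u, f v}" "u \<in> verts F" "v \<in> verts F"
      by auto
    then show "e \<in> image f ` edges F"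
      using edge [of u v] e by (intro image_eqI [of _ _ "{u, v}"]) auto
  next
    fix e assume "e \<in> image f ` edges F"
    then obtain d where d: "e = f ` d" "d \<in> edges F"
      by auto
    then obtain u v where "d = {u, v}"
      using rgraphD(3) [OF F d(2)] by (auto simp: card_2_iff)
    then show "e \<in> edges G"
      using d edge [of u v] rgraphD(2) [OF F d(2)] by auto
  qed
  then have "G = image_graph f F"
    using f by (intro rooted_graph_eqI) (auto simp: bij_betw_def)
  then show "\<exists>f. inj_on f (verts F) \<and> G = image_graph f F"
    using f(1) by (auto simp: bij_betw_def)
next
  assume "\<exists>f. inj_on f (verts F) \<and> G = image_graph f F"
  then obtain f where f: "inj_on f (verts F)" "G = image_graph f F"
    by auto
  have "{u, v} \<in> edges F \<longleftrightarrow> {f u, f v} \<in> edges G" if "u \<in> verts F" "v \<in> verts F" for u v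
  proof -
    have "f ` {u, v} = f ` e \<longleftrightarrow> {u, v} = e" if "e \<in> edges F" for e
      using \<open>u \<in> verts F\<close> \<open>v \<in> verts F\<close> rgraphD(2) [OF F that] by (intro inj_on_image_eq_iff [OF f(1)]) auto
    then show ?thesis
      unfolding f(2) by (auto simp: image_iff)
  qed
  then show "rooted_iso F G"
    using f by (auto simp: rooted_iso_def bij_betw_def)
qed

text \<open>Plain inversion yields the tree added last, whose shape may be another member of the
  multiset. The induction finds a tree of shape \<open>Node N\<close> deeper in the sum and moves it
  to the front.\<close>

lemma has_shape_add_msetE:
  assumes "has_shape G (add_mset (Node N) M)"
  obtains r G1 G2 where "G = graph_sum (add_root r G1) G2" "has_shape G1 N" "has_shape G2 M"
    "r \<notin> verts G1" "verts (add_root r G1) \<inter> verts G2 = {}"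
proof -
  have "\<exists>r G1 G2. G = graph_sum (add_root r G1) G2 \<and> has_shape G1 N \<and> has_shape G2 M \<and>
      r \<notin> verts G1 \<and> verts (add_root r G1) \<inter> verts G2 = {}"
    using assms
  proof (induction G "add_mset (Node N) M" arbitrary: M rule: has_shape.induct)
    case null
    then show ?case
      by simp
  next
    case (sum A N' B M' s)
    show ?case
    proof (cases "N' = N \<and> M' = M")
      case True
      then show ?thesis
        using sum.hyps by blast
    next
      case False
      then obtain K where K: "M' = add_mset (Node N) K" "M = add_mset (Node N') K"
        using sum.hyps(7) by (auto simp: add_eq_conv_ex)
      obtain r G1 G2 where B: "B = graph_sum (add_root r G1) G2" "has_shape G1 N" "has_shape G2 K"
          "r \<notin> verts G1" "verts (add_root r G1) \<inter> verts G2 = {}"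
        using sum.hyps(4) [OF K(1)] by blast
      have "has_shape (graph_sum (add_root s A) G2) M"
        unfolding K(2) using sum.hyps(1,5,6) B by (intro has_shape.sum) auto
      moreover have "verts (add_root r G1) \<inter> verts (graph_sum (add_root s A) G2) = {}"
        using sum.hyps(6) B(5) unfolding B(1) by auto
      ultimately show ?thesis
        using B by (auto simp: graph_sum_left_commute intro!: exI)
    qed
  qed
  then show ?thesis
    using that by blast
qed

lemma has_shape_iso:
  assumes "has_shape F M" "has_shape G M"
  shows "\<exists>f. inj_on f (verts F) \<and> G = image_graph f F"
  using assms
proof (induction arbitrary: G rule: has_shape.induct)
  case null
  then have "G = null_graph"
    by cases auto
  then show ?case
    by simp
next
  case (sum A N B M r)
  obtain s A' B' where G: "G = graph_sum (add_root s A') B'" and A': "has_shape A' N" and B': "has_shape B' M"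
    and disj: "s \<notin> verts A'" "verts (add_root s A') \<inter> verts B' = {}"
    using sum.prems by (rule has_shape_add_msetE)
  obtain f where f: "inj_on f (verts A)" "A' = image_graph f A"
    using sum.IH(1) [OF A'] by auto
  obtain g where g: "inj_on g (verts B)" "B' = image_graph g B"
    using sum.IH(2) [OF B'] by auto
  \<comment> \<open>The cases do not overlap: \<open>r\<close>, the vertices of \<open>A\<close> and
    those of \<open>B\<close> are kept apart by the derivation.\<close>
  define h where "h v = (if v = r then s else if v \<in> verts A then f v else g v)" for v
  have h: "h r = s" "\<And>v. v \<in> verts A \<Longrightarrow> h v = f v" "\<And>v. v \<in> verts B \<Longrightarrow> h v = g v"
    using sum.hyps(3,4) by (auto simp: h_def)
  have "image_graph h A = image_graph f A" "image_graph h B = image_graph g B"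
    using h sum.hyps(1,2) by (auto intro: image_graph_cong has_shape_rgraph)
  then have "G = image_graph h (graph_sum (add_root r A) B)"
    using h(1) by (simp add: G f g)
  moreover have "inj_on h (verts (graph_sum (add_root r A) B))"
  proof -
    have "inj_on h (verts A)" "inj_on h (verts B)" "h ` verts A = verts A'" "h ` verts B = verts B'"
      using f g h by (auto simp: inj_on_def)
    then show ?thesis
      using disj sum.hyps(3,4) h(1) by (auto simp: inj_on_Un)
  qed
  ultimately show ?case
    by blast
qed

section \<open>Decomposition of rooted forests\<close>

text \<open>The components serve as the family of trees: they inherit acyclicity, and
  \<open>ex\<close> and \<open>unique\<close> give each of them exactly one root.\<close>

lemma rooted_forestI:
  assumes F: "rgraph F" and acyclic: "\<nexists>p. graph_cycle F p"
    and ex: "\<And>v. v \<in> verts F \<Longrightarrow> \<exists>s\<in>roots F. linked F v s"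
    and unique: "\<And>s s'. s \<in> roots F \<Longrightarrow> s' \<in> roots F \<Longrightarrow> linked F s s' \<Longrightarrow> s = s'"
  shows "rooted_forest F"
  unfolding rooted_forest_def
proof (intro exI conjI ballI impI)
  show "finite (graph_components F)"
    using rgraphD(1) [OF F] by (simp add: graph_components_def)
  have class_eq: "{w. linked F u w} = {w. linked F v w}" if "linked F u v" for u v
    using that linked_trans linked_sym by fast
  show "rooted_tree T" if "T \<in> graph_components F" for T
  proof -
    obtain v where v: "v \<in> verts F" and T: "T = induced F {w. linked F v w}"
      using \<open>T \<in> graph_components F\<close> by (auto simp: graph_components_def)
    have "simple_graph T"
      using F by (auto simp: T rgraph_def simple_graph_def induced_def)
    moreover have "connected_graph T"
      unfolding T
    proof (rule connected_induced)
      show "v \<in> {w. linked F v w}"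
        using v by (simp add: linked_refl)
      show "\<exists>p. graph_path F p \<and> hd p = v \<and> last p = w \<and> set p \<subseteq> {w. linked F v w}"
        if "w \<in> {w. linked F v w}" for w
        using that linked_path_hd [of F] by (auto simp: linked_def)
    qed
    moreover have "\<nexists>p. graph_cycle T p"
      using acyclic by (auto simp: T graph_cycle_def graph_path_induced) (auto simp: induced_def)
    moreover obtain s where s: "s \<in> roots F" "linked F v s"
      using ex [OF v] by auto
    then have "roots T = {s}"
      using unique linked_trans [OF linked_sym [OF s(2)]] by (auto simp: T induced_def)
    moreover have "s \<in> verts T"
      using s linked_verts [OF s(2)] by (simp add: T induced_def)
    ultimately show "rooted_tree T"
      by (auto simp: rooted_tree_def)
  qed
  show "verts T \<inter> verts T' = {}"
    if "T \<in> graph_components F" "T' \<in> graph_components F" "T \<noteq> T'" for T T'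
  proof -
    obtain u v where T: "T = induced F {w. linked F u w}" "T' = induced F {w. linked F v w}"
      using \<open>T \<in> graph_components F\<close> \<open>T' \<in> graph_components F\<close> by (auto simp: graph_components_def)
    have "\<not> (linked F u w \<and> linked F v w)" for w
      using class_eq [of u w] class_eq [of v w] \<open>T \<noteq> T'\<close> by (auto simp: T)
    then show ?thesis
      by (auto simp: T induced_def)
  qed
  show "F = graph_union (graph_components F)"
  proof (rule rooted_graph_eqI)
    show "edges F = edges (graph_union (graph_components F))"
    proof (intro equalityI subsetI)
      fix e assume e: "e \<in> edges F"
      then obtain a b where ab: "e = {a, b}"
        using rgraphD(3) [OF F e] by (auto simp: card_2_iff)
      then have "a \<in> verts F" "b \<in> verts F"
        using rgraphD(2) [OF F e] by auto
      moreover from this have "linked F a b"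
        using e ab by (intro linked_step [of a b] linked_refl) auto
      ultimately show "e \<in> edges (graph_union (graph_components F))"
        using e ab by (auto simp: graph_components_def induced_def intro!: bexI [of _ a] linked_refl)
    qed (auto simp: graph_components_def induced_def)
  qed (use rgraphD(5) [OF F] linked_refl [of _ F] in
      \<open>auto simp: graph_components_def induced_def intro!: bexI\<close>)
qed

text \<open>After deleting the root \<open>r\<close>, its neighbours become the roots. Connectedness
  gives every component one of them, and two in the same component would close a cycle through
  \<open>r\<close>.\<close>

lemma rooted_tree_add_root:
  assumes T: "rooted_tree T"
  obtains r F where "T = add_root r F" "r \<notin> verts F" "rooted_forest F"
proof -
  obtain r where r: "r \<in> verts T" "roots T = {r}"
    using T by (auto simp: rooted_tree_def)
  have gT: "rgraph T" and conn: "connected_graph T" and acyclic: "\<nexists>p. graph_cycle T p"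
    using T r by (auto simp: rooted_tree_def rgraph_def)
  define F where "F = \<lparr>verts = verts T - {r}, edges = {e \<in> edges T. r \<notin> e}, roots = {s. {r, s} \<in> edges T}\<rparr>"
  have rF: "r \<notin> verts F"
    by (simp add: F_def)
  have eq: "T = add_root r F"
  proof (rule rooted_graph_eqI)
    have "\<exists>s. e = {r, s}" if "e \<in> edges T" "r \<in> e" for e
      using rgraphD(3) [OF gT that(1)] that(2) by (auto simp: card_2_iff)
    then show "edges T = edges (add_root r F)"
      by (auto simp: F_def)
  qed (use r in \<open>auto simp: F_def\<close>)
  have gF: "rgraph F"
    using gT rgraph_edge [OF gT, of r] by (auto simp: F_def rgraph_def simple_graph_def)
  have "rooted_forest F"
  proof (rule rooted_forestI [OF gF])
    show "\<nexists>p. graph_cycle F p"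
    proof
      assume "\<exists>p. graph_cycle F p"
      then obtain p where p: "graph_cycle F p" ..
      then have "r \<notin> set p"
        using graph_path_verts [of F p] rF by (auto simp: graph_cycle_def)
      then have "graph_cycle T p"
        using p by (auto simp: graph_cycle_def eq graph_path_add_root_avoiding)
      then show False
        using acyclic by blast
    qed
    show "\<exists>s\<in>roots F. linked F v s" if "v \<in> verts F" for v
    proof -
      have "linked T r v"
        using conn r that by (auto simp: connected_graph_def F_def)
      then obtain p where p: "graph_path T p" "hd p = r" "last p = v"
        by (auto simp: linked_def)
      \<comment> \<open>Dropping \<open>r\<close> leaves a path that starts at a neighbour of
        \<open>r\<close>; it is nonempty because \<open>v\<close> is not \<open>r\<close>.\<close>
      then obtain q where "p = r # q"
        by (cases p) auto
      then have q: "root_path F q" "last q = v"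
        using p that rF graph_path_add_root_Cons [OF gF rF, of q] by (auto simp: eq split: if_splits)
      then have "linked F (hd q) v"
        by (auto simp: linked_def root_path_def)
      then show ?thesis
        using q(1) by (auto simp: root_path_def intro: linked_sym)
    qed
    show "s = s'" if s: "s \<in> roots F" "s' \<in> roots F" "linked F s s'" for s s'
    proof (rule ccontr)
      assume "s \<noteq> s'"
      obtain p where p: "graph_path F p" "hd p = s" "last p = s'"
        using s(3) by (auto simp: linked_def)
      \<comment> \<open>Distinct ends give two vertices, and \<open>r\<close> the third that a cycle
        requires.\<close>
      then have "length p \<ge> 2"
        using \<open>s \<noteq> s'\<close> by (cases p; cases "tl p") auto
      moreover have "graph_path T (r # p)"
        using p s(1) graph_path_add_root_Cons [OF gF rF, of p] by (auto simp: eq root_path_def)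
      moreover have "{last p, r} \<in> edges T"
        using p(3) s(2) by (simp add: F_def insert_commute)
      ultimately have "graph_cycle T (r # p)"
        by (auto simp: graph_cycle_def)
      then show False
        using acyclic by blast
    qed
  qed
  then show ?thesis
    using that eq rF by blast
qed

lemma rooted_forest_finite: "rooted_forest F \<Longrightarrow> finite (verts F)"
  by (auto simp: rooted_forest_def rooted_tree_def simple_graph_def)

text \<open>The outer induction on the number of vertices handles the forest below each root; the
  inner one assembles subfamilies of the given trees.\<close>

lemma rooted_forest_has_shape:
  assumes "rooted_forest F"
  shows "\<exists>M. has_shape F M"
  using assms
proof (induction "card (verts F)" arbitrary: F rule: less_induct)
  case less
  obtain \<T> where \<T>: "finite \<T> \<and> (\<forall>T\<in>\<T>. rooted_tree T) \<and>
      (\<forall>T\<in>\<T>. \<forall>T'\<in>\<T>. T \<noteq> T' \<longrightarrow> verts T \<inter> verts T' = {}) \<and> F = graph_union \<T>"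
    using less.prems unfolding rooted_forest_def ..
  then have fin: "finite \<T>" and F: "F = graph_union \<T>"
    by simp_all
  have "\<exists>M. has_shape (graph_union \<U>) M" if "\<U> \<subseteq> \<T>" for \<U>
    using finite_subset [OF that fin] that
  proof (induction rule: finite_induct)
    case empty
    then show ?case
      by (auto simp: graph_union_empty intro: has_shape.null)
  next
    case (insert T \<U>)
    then obtain M where M: "has_shape (graph_union \<U>) M"
      by auto
    obtain r G where T: "T = add_root r G" "r \<notin> verts G" "rooted_forest G"
      by (rule rooted_tree_add_root [of T]) (use insert.prems \<T> in auto)
    have "verts T \<subseteq> verts F"
      using insert.prems by (auto simp: F)
    \<comment> \<open>The root \<open>r\<close> belongs to \<open>T\<close> but not to
      \<open>G\<close>, which makes the number of vertices drop.\<close>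
    then have "verts G \<subset> verts F"
      using T(1,2) by auto
    then have "card (verts G) < card (verts F)"
      using rooted_forest_finite [OF less.prems] by (intro psubset_card_mono)
    then obtain N where "has_shape G N"
      using less.hyps T(3) by blast
    moreover have "verts T \<inter> verts (graph_union \<U>) = {}"
      using insert.hyps(2) insert.prems \<T> by fastforce
    ultimately have "has_shape (graph_sum (add_root r G) (graph_union \<U>)) (add_mset (Node N) M)"
      using M T(1,2) by (intro has_shape.sum) auto
    then show ?case
      unfolding graph_union_insert T(1) by blast
  qed
  then show ?case
    by (simp add: F)
qed

theorem theorem5p1:
  fixes F1 :: "'a rooted_graph" and F2 :: "'b rooted_graph"
  assumes "rooted_forest F1" and "rooted_forest F2"
  shows "(P_poly F1 = P_poly F2 \<longleftrightarrow> rooted_iso F1 F2) \<and>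
         (S_poly F1 = S_poly F2 \<longleftrightarrow> rooted_iso F1 F2)"
proof -
  obtain M N where M: "has_shape F1 M" and N: "has_shape F2 N"
    using rooted_forest_has_shape [OF assms(1)] rooted_forest_has_shape [OF assms(2)] by blast
  note iso = rooted_iso_iff [OF has_shape_rgraph [OF M] has_shape_rgraph [OF N]]
  have "rooted_iso F1 F2" if "M = N"
    unfolding iso using has_shape_iso [OF M] N that by simp
  moreover have "P_poly F1 = P_poly F2 \<and> S_poly F1 = S_poly F2" if "rooted_iso F1 F2"
  proof -
    have "has_shape F2 M"
      using that has_shape_image [OF M] unfolding iso by blast
    then show ?thesis
      using has_shape_P_poly has_shape_S_poly M by metis
  qed
  moreover have "M = N" if "P_poly F1 = P_poly F2"
    using that unfolding has_shape_P_poly [OF M] has_shape_P_poly [OF N] by (rule P_shape_complete)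
  moreover have "M = N" if "S_poly F1 = S_poly F2"
    using that has_shape_S_poly [OF M] has_shape_S_poly [OF N] by (intro S_shape_complete) simp
  ultimately show ?thesis
    by blast
qed

end
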